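(* Let $(T\colon H\to B,\varphi_H)$ be a relative Rota-Baxter operator in $\mathsf{C}$ with $H$ cocommutative, and assume that $T\colon H\to B$ is an isomorphism. Let $\overline{\mathbb{H}}=(H,\overline{H})$ be the Hopf brace associated to $(T\colon H\to B,\varphi_H)$. Then the functor $\mathsf{V}\colon{}_{\overline{\mathbb{H}}}\mathsf{Mod}\to{}_{(T,\varphi_H)}\mathsf{Mod}$ defined by $$\mathsf{V}((M,\overline{\psi}_M^1,\overline{\psi}_M^2))=(M,M,\overline{\psi}_M^1,\overline{\Gamma}_M\circ(T^{-1}\otimes M),\overline{\psi}_M^2\circ(T^{-1}\otimes M),id_M),\qquad \mathsf{V}(f)=(f,f),$$ where $\overline{\Gamma}_M=\overline{\psi}_M^1\circ(\lambda_H\otimes\overline{\psi}_M^2)\circ(\delta_H\otimes M)$, is left adjoint to the functor $\mathsf{U}\colon{}_{(T,\varphi_H)}\mathsf{Mod}\to{}_{\overline{\mathbb{H}}}\mathsf{Mod}$ defined by $$\mathsf{U}((M,N,\phi_M,\varphi_M,\varphi_N,\gamma))=(M,\phi_M,\overline{\varphi}_M),\quad \overline{\varphi}_M=\phi_M\circ(H\otimes(\varphi_M\circ(T\otimes M)))\circ(\delta_H\otimes M),\qquad \mathsf{U}(r,s)=r.$$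
   Context: $\mathsf{C}$ is a strict braided monoidal category with tensor product $\otimes$, unit object $K$ and braiding $c$. For an object $P$ and a morphism $f$, write $P\otimes f$ for $id_P\otimes f$ and $f\otimes P$ for $f\otimes id_P$. (Co)algebras, Hopf algebras and modules are taken in $\mathsf{C}$. A Hopf algebra is written $X=(X,\eta_X,\mu_X,\varepsilon_X,\delta_X,\lambda_X)$; it is cocommutative if $c_{X,X}\circ\delta_X=\delta_X$. Tensor products of algebras and coalgebras carry $\mu_{A\otimes B}=(\mu_A\otimes\mu_B)\circ(A\otimes c_{B,A}\otimes B)$ and $\delta_{D\otimes E}=(D\otimes c_{D,E}\otimes E)\circ(\delta_D\otimes\delta_E)$. For a Hopf algebra $X$ and an algebra-coalgebra $A$, $(A,\varphi_A)$ is a left $X$-module algebra-coalgebra if $(A,\varphi_A)$ is a left $X$-module, $\varphi_A\circ(X\otimes\eta_A)=\varepsilon_X\otimes\eta_A$, $\varphi_A\circ(X\otimes\mu_A)=\mu_A\circ(\varphi_A\otimes\varphi_A)\circ(X\otimes c_{X,A}\otimes A)\circ(\delta_X\otimes A\otimes A)$, and $\varphi_A\colon X\otimes A\to A$ is a coalgebra morphism. Relative Rota-Baxter operator $(T\colon H\to B,\varphi_H)$: $H$, $B$ are Hopf algebras, $(H,\varphi_H)$ is a left $B$-module algebra-coalgebra and $T\colon H\to B$ is a coalgebra morphism with $\mu_B\circ(T\otimes T)=T\circ\mu_H\circ(H\otimes(\varphi_H\circ(T\otimes H)))\circ(\delta_H\otimes H)$. A left module over $(T\colon H\to B,\varphi_H)$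 is a 6-tuple $(M,N,\phi_M,\varphi_M,\varphi_N,\gamma)$ such that: (i) $(M,\phi_M)$ is a left $H$-module, $(M,\varphi_M)$ is a left $B$-module and $\varphi_M\circ(B\otimes\phi_M)=\phi_M\circ(\varphi_H\otimes\varphi_M)\circ(B\otimes c_{B,H}\otimes M)\circ(\delta_B\otimes H\otimes M)$; (ii) $(N,\varphi_N)$ is a left $B$-module; (iii) $\gamma\colon M\to N$ is a morphism in $\mathsf{C}$ with $\varphi_N\circ(T\otimes\gamma)=\gamma\circ\phi_M\circ(H\otimes(\varphi_M\circ(T\otimes M)))\circ(\delta_H\otimes M)$. A morphism $(M,N,\phi_M,\varphi_M,\varphi_N,\gamma)\to(P,Q,\phi_P,\varphi_P,\varphi_Q,\theta)$ is a pair $(r,s)$ with $r\colon M\to P$ a morphism of left $H$-modules (for $\phi_M,\phi_P$) and of left $B$-modules (for $\varphi_M,\varphi_P$), $s\colon N\to Q$ a morphism of left $B$-modules, and $s\circ\gamma=\theta\circ r$. These form the category ${}_{(T,\varphi_H)}\mathsf{Mod}$. Hopf brace $\mathbb{H}=(H_1,H_2)$: Hopf algebras $H_1=(H,\eta_H,\mu_H^1,\varepsilon_H,\delta_H,\lambda_H^1)$, $H_2=(H,\eta_H,\mu_H^2,\varepsilon_H,\delta_H,\lambda_H^2)$ on the same coalgebra with $\mu_H^2\circ(H\otimes\mu_H^1)=\mu_H^1\circ(\mu_H^2\otimes\Gamma_{H_1})\circ(H\otimes c_{H,H}\otimes H)\circ(\delta_H\otimes H\otimes H)$, where $\Gamma_{H_1}=\mu_H^1\circ(\lambda_H^1\otimes\mu_H^2)\circ(\delta_H\otimes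 H)$. A left module over a Hopf brace $\mathbb{H}$ is a triple $(M,\psi_M^1,\psi_M^2)$ with $(M,\psi_M^1)$ a left $H_1$-module, $(M,\psi_M^2)$ a left $H_2$-module and $\psi_M^2\circ(H\otimes\psi_M^1)=\psi_M^1\circ(\mu_H^2\otimes\Gamma_M)\circ(H\otimes c_{H,H}\otimes M)\circ(\delta_H\otimes H\otimes M)$, where $\Gamma_M=\psi_M^1\circ(\lambda_H^1\otimes\psi_M^2)\circ(\delta_H\otimes M)$. Morphisms are morphisms in $\mathsf{C}$ that are both left $H_1$-module and left $H_2$-module morphisms. This is the category ${}_{\mathbb{H}}\mathsf{Mod}$. Hopf brace associated to $(T\colon H\to B,\varphi_H)$ with $H$ cocommutative: $\overline{\mathbb{H}}=(H,\overline{H})$, where the first structure is $H$ itself and $\overline{H}=(H,\eta_H,\overline{\mu}_H,\varepsilon_H,\delta_H,\overline{\lambda}_H)$ with $\overline{\mu}_H=\mu_H\circ(H\otimes(\varphi_H\circ(T\otimes H)))\circ(\delta_H\otimes H)$, $\overline{\lambda}_H=\varphi_H\circ((\lambda_B\circ T)\otimes\lambda_H)\circ\delta_H$. *)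

theory Defs
  imports Main
begin

section \<open>Categories, functors and adjunctions\<close>

text \<open>Composition is written in the usual order: \<open>g \<cdot> f\<close> means ``first \<open>f\<close>, then \<open>g\<close>''. The values
  of all operations are irrelevant outside of their intended domains.\<close>

record ('o, 'm) category_data =
  Obj :: "'o set"
  Arr :: "'m set"
  Dom :: "'m \<Rightarrow> 'o"
  Cod :: "'m \<Rightarrow> 'o"
  Ident :: "'o \<Rightarrow> 'm"  (\<open>\<one>\<index>\<close>)
  Comp :: "'m \<Rightarrow> 'm \<Rightarrow> 'm"  (infixr \<open>\<cdot>\<index>\<close> 55)

definition hom :: "('o, 'm, 'z) category_data_scheme \<Rightarrow> 'o \<Rightarrow> 'o \<Rightarrow> 'm set" where
  "hom C A B = {f \<in> Arr C. Dom C f = A \<and> Cod C f = B}"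

locale category =
  fixes C :: "('o, 'm, 'z) category_data_scheme" (structure)
  assumes dom_cod_obj: "f \<in> Arr C \<Longrightarrow> Dom C f \<in> Obj C \<and> Cod C f \<in> Obj C"
    and ident_hom: "A \<in> Obj C \<Longrightarrow> \<one> A \<in> hom C A A"
    and comp_hom: "\<lbrakk>f \<in> Arr C; g \<in> Arr C; Dom C g = Cod C f\<rbrakk> \<Longrightarrow> g \<cdot> f \<in> hom C (Dom C f) (Cod C g)"
    and comp_ident_left: "f \<in> Arr C \<Longrightarrow> \<one> (Cod C f) \<cdot> f = f"
    and comp_ident_right: "f \<in> Arr C \<Longrightarrow> f \<cdot> \<one> (Dom C f) = f"
    and comp_assoc: "\<lbrakk>f \<in> Arr C; g \<in> Arr C; h \<in> Arr C; Dom C g = Cod C f; Dom C h = Cod C g\<rbrakk>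
      \<Longrightarrow> (h \<cdot> g) \<cdot> f = h \<cdot> (g \<cdot> f)"

definition inverse_arrows :: "('o, 'm, 'z) category_data_scheme \<Rightarrow> 'm \<Rightarrow> 'm \<Rightarrow> bool" where
  "inverse_arrows C f g \<longleftrightarrow>
     f \<in> Arr C \<and> g \<in> hom C (Cod C f) (Dom C f) \<and>
     g \<cdot>\<^bsub>C\<^esub> f = \<one>\<^bsub>C\<^esub> (Dom C f) \<and> f \<cdot>\<^bsub>C\<^esub> g = \<one>\<^bsub>C\<^esub> (Cod C f)"

definition isomorphism :: "('o, 'm, 'z) category_data_scheme \<Rightarrow> 'm \<Rightarrow> bool" where
  "isomorphism C f \<longleftrightarrow> (\<exists>g. inverse_arrows C f g)"

definition inverse_of :: "('o, 'm, 'z) category_data_scheme \<Rightarrow> 'm \<Rightarrow> 'm" where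
  "inverse_of C f = (THE g. inverse_arrows C f g)"

record ('o1, 'm1, 'o2, 'm2) functor_data =
  on_obj :: "'o1 \<Rightarrow> 'o2"
  on_arr :: "'m1 \<Rightarrow> 'm2"

locale is_functor = dom: category C + cod: category D
  for C :: "('o1, 'm1, 'y) category_data_scheme"
    and D :: "('o2, 'm2, 'z) category_data_scheme"
    and F :: "('o1, 'm1, 'o2, 'm2) functor_data" +
  assumes functor_obj: "A \<in> Obj C \<Longrightarrow> on_obj F A \<in> Obj D"
    and functor_arr: "f \<in> Arr C
      \<Longrightarrow> on_arr F f \<in> hom D (on_obj F (Dom C f)) (on_obj F (Cod C f))"
    and functor_ident: "A \<in> Obj C \<Longrightarrow> on_arr F (\<one>\<^bsub>C\<^esub> A) = \<one>\<^bsub>D\<^esub> (on_obj F A)"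
    and functor_comp: "\<lbrakk>f \<in> Arr C; g \<in> Arr C; Dom C g = Cod C f\<rbrakk>
      \<Longrightarrow> on_arr F (g \<cdot>\<^bsub>C\<^esub> f) = on_arr F g \<cdot>\<^bsub>D\<^esub> on_arr F f"

text \<open>\<open>F : C \<rightarrow> D\<close> is left adjoint to \<open>G : D \<rightarrow> C\<close>: there is a bijection
  \<open>D(F A, B) \<cong> C(A, G B)\<close>, natural in \<open>A\<close> and \<open>B\<close>.\<close>

definition left_adjoint ::
  "('o1, 'm1, 'y) category_data_scheme \<Rightarrow> ('o2, 'm2, 'z) category_data_scheme
    \<Rightarrow> ('o1, 'm1, 'o2, 'm2) functor_data \<Rightarrow> ('o2, 'm2, 'o1, 'm1) functor_data \<Rightarrow> bool" where
  "left_adjoint C D F G \<longleftrightarrow>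
     is_functor C D F \<and> is_functor D C G \<and>
     (\<exists>\<Phi> :: 'o1 \<Rightarrow> 'o2 \<Rightarrow> 'm2 \<Rightarrow> 'm1.
        (\<forall>A \<in> Obj C. \<forall>B \<in> Obj D.
           bij_betw (\<Phi> A B) (hom D (on_obj F A) B) (hom C A (on_obj G B))) \<and>
        (\<forall>A \<in> Obj C. \<forall>A' \<in> Obj C. \<forall>B \<in> Obj D. \<forall>B' \<in> Obj D.
           \<forall>f \<in> hom C A' A. \<forall>g \<in> hom D B B'. \<forall>h \<in> hom D (on_obj F A) B.
             \<Phi> A' B' (g \<cdot>\<^bsub>D\<^esub> h \<cdot>\<^bsub>D\<^esub> on_arr F f) = on_arr G g \<cdot>\<^bsub>C\<^esub> \<Phi> A B h \<cdot>\<^bsub>C\<^esub> f))"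

text \<open>A category presented by possibly overlapping hom-sets: an arrow carries its source and its
  target, so that for instance one morphism of the base category may underlie module morphisms
  between different modules.\<close>

definition hom_category ::
  "'a set \<Rightarrow> ('a \<Rightarrow> 'a \<Rightarrow> 'f set) \<Rightarrow> ('a \<Rightarrow> 'f) \<Rightarrow> ('f \<Rightarrow> 'f \<Rightarrow> 'f)
    \<Rightarrow> ('a, 'a \<times> 'f \<times> 'a) category_data" where
  "hom_category Ob Hm idn cmp =
     \<lparr>Obj = Ob,
      Arr = {(X, f, Y). X \<in> Ob \<and> Y \<in> Ob \<and> f \<in> Hm X Y},
      Dom = (\<lambda>(X, f, Y). X),
      Cod = (\<lambda>(X, f, Y). Y),
      Ident = (\<lambda>X. (X, idn X, X)),
      Comp = (\<lambda>(Y', g, Z) (X, f, Y). (X, cmp g f, Z))\<rparr>"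

definition hom_functor ::
  "('a \<Rightarrow> 'b) \<Rightarrow> ('f \<Rightarrow> 'g) \<Rightarrow> ('a, 'a \<times> 'f \<times> 'a, 'b, 'b \<times> 'g \<times> 'b) functor_data" where
  "hom_functor F \<phi> = \<lparr>on_obj = F, on_arr = (\<lambda>(X, f, Y). (F X, \<phi> f, F Y))\<rparr>"

section \<open>Strict braided monoidal categories\<close>

record ('o, 'm) braided_data = "('o, 'm) category_data" +
  TensorObj :: "'o \<Rightarrow> 'o \<Rightarrow> 'o"  (infixr \<open>\<boxtimes>\<index>\<close> 70)
  TensorArr :: "'m \<Rightarrow> 'm \<Rightarrow> 'm"  (infixr \<open>\<otimes>\<index>\<close> 70)
  UnitObj :: "'o"  (\<open>\<K>\<index>\<close>)
  Braid :: "'o \<Rightarrow> 'o \<Rightarrow> 'm"  (\<open>\<c>\<index>\<close>)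

text \<open>The locale \<open>braided\<close> only fixes the structure \<open>C\<close> and carries no assumptions.\<close>

locale braided =
  fixes C :: "('o, 'm) braided_data" (structure)

locale strict_braided_monoidal_category = braided C + category C
  for C :: "('o, 'm) braided_data" (structure) +
  assumes unit_obj: "\<K> \<in> Obj C"
    and tensor_obj: "\<lbrakk>P \<in> Obj C; Q \<in> Obj C\<rbrakk> \<Longrightarrow> P \<boxtimes> Q \<in> Obj C"
    and tensor_arr: "\<lbrakk>f \<in> Arr C; g \<in> Arr C\<rbrakk>
      \<Longrightarrow> f \<otimes> g \<in> hom C (Dom C f \<boxtimes> Dom C g) (Cod C f \<boxtimes> Cod C g)"
    and tensor_ident: "\<lbrakk>P \<in> Obj C; Q \<in> Obj C\<rbrakk> \<Longrightarrow> \<one> P \<otimes> \<one> Q = \<one> (P \<boxtimes> Q)"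
    and interchange: "\<lbrakk>f \<in> Arr C; g \<in> Arr C; f' \<in> Arr C; g' \<in> Arr C;
        Dom C g = Cod C f; Dom C g' = Cod C f'\<rbrakk>
      \<Longrightarrow> (g \<cdot> f) \<otimes> (g' \<cdot> f') = (g \<otimes> g') \<cdot> (f \<otimes> f')"
    and tensor_obj_assoc: "\<lbrakk>P \<in> Obj C; Q \<in> Obj C; R \<in> Obj C\<rbrakk>
      \<Longrightarrow> (P \<boxtimes> Q) \<boxtimes> R = P \<boxtimes> (Q \<boxtimes> R)"
    and tensor_arr_assoc: "\<lbrakk>f \<in> Arr C; g \<in> Arr C; h \<in> Arr C\<rbrakk>
      \<Longrightarrow> (f \<otimes> g) \<otimes> h = f \<otimes> (g \<otimes> h)"
    and tensor_obj_unit: "P \<in> Obj C \<Longrightarrow> \<K> \<boxtimes> P = P \<and> P \<boxtimes> \<K> = P"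
    and tensor_arr_unit: "f \<in> Arr C \<Longrightarrow> \<one> \<K> \<otimes> f = f \<and> f \<otimes> \<one> \<K> = f"
    and braid_hom: "\<lbrakk>P \<in> Obj C; Q \<in> Obj C\<rbrakk> \<Longrightarrow> \<c> P Q \<in> hom C (P \<boxtimes> Q) (Q \<boxtimes> P)"
    and braid_iso: "\<lbrakk>P \<in> Obj C; Q \<in> Obj C\<rbrakk> \<Longrightarrow> isomorphism C (\<c> P Q)"
    and braid_natural: "\<lbrakk>f \<in> Arr C; g \<in> Arr C\<rbrakk>
      \<Longrightarrow> \<c> (Cod C f) (Cod C g) \<cdot> (f \<otimes> g) = (g \<otimes> f) \<cdot> \<c> (Dom C f) (Dom C g)"
    and braid_tensor_right: "\<lbrakk>P \<in> Obj C; Q \<in> Obj C; R \<in> Obj C\<rbrakk>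
      \<Longrightarrow> \<c> P (Q \<boxtimes> R) = (\<one> Q \<otimes> \<c> P R) \<cdot> (\<c> P Q \<otimes> \<one> R)"
    and braid_tensor_left: "\<lbrakk>P \<in> Obj C; Q \<in> Obj C; R \<in> Obj C\<rbrakk>
      \<Longrightarrow> \<c> (P \<boxtimes> Q) R = (\<c> P R \<otimes> \<one> Q) \<cdot> (\<one> P \<otimes> \<c> Q R)"

section \<open>Hopf algebras and their modules\<close>

record ('o, 'm) alg_coalg =
  carr :: 'o
  alg_unit :: 'm  (\<open>\<eta>\<index>\<close>)
  alg_mult :: 'm  (\<open>\<mu>\<index>\<close>)
  counit :: 'm  (\<open>\<epsilon>\<index>\<close>)
  comult :: 'm  (\<open>\<delta>\<index>\<close>)

record ('o, 'm) hopf = "('o, 'm) alg_coalg" +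
  antipode :: 'm

type_synonym ('o, 'm) coalgebra = "'o \<times> 'm \<times> 'm"
  \<comment> \<open>underlying object, counit, comultiplication\<close>

text \<open>Left modules over a relative Rota-Baxter operator are tuples
  \<open>(M, N, \<phi>M, \<psi>M, \<psi>N, \<gamma>)\<close>, where \<open>\<phi>M\<close> is the \<open>H\<close>-action and \<open>\<psi>M\<close>, \<open>\<psi>N\<close> are the
  \<open>B\<close>-actions; left modules over a Hopf brace are triples \<open>(M, \<psi>1, \<psi>2)\<close>.\<close>

type_synonym ('o, 'm) rb_mod = "'o \<times> 'o \<times> 'm \<times> 'm \<times> 'm \<times> 'm"
type_synonym ('o, 'm) brace_mod = "'o \<times> 'm \<times> 'm"

definition coalg_of :: "('o, 'm, 'z) alg_coalg_scheme \<Rightarrow> ('o, 'm) coalgebra" where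
  "coalg_of D = (carr D, \<epsilon>\<^bsub>D\<^esub>, \<delta>\<^bsub>D\<^esub>)"

context braided
begin

definition is_algebra :: "('o, 'm, 'z) alg_coalg_scheme \<Rightarrow> bool" where
  "is_algebra A \<longleftrightarrow>
     carr A \<in> Obj C \<and>
     \<eta>\<^bsub>A\<^esub> \<in> hom C \<K> (carr A) \<and> \<mu>\<^bsub>A\<^esub> \<in> hom C (carr A \<boxtimes> carr A) (carr A) \<and>
     \<mu>\<^bsub>A\<^esub> \<cdot> (\<one> (carr A) \<otimes> \<eta>\<^bsub>A\<^esub>) = \<one> (carr A) \<and>
     \<mu>\<^bsub>A\<^esub> \<cdot> (\<eta>\<^bsub>A\<^esub> \<otimes> \<one> (carr A)) = \<one> (carr A) \<and>
     \<mu>\<^bsub>A\<^esub> \<cdot> (\<one> (carr A) \<otimes> \<mu>\<^bsub>A\<^esub>) = \<mu>\<^bsub>A\<^esub> \<cdot> (\<mu>\<^bsub>A\<^esub> \<otimes> \<one> (carr A))"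

fun is_coalgebra :: "('o, 'm) coalgebra \<Rightarrow> bool" where
  "is_coalgebra (D, e, d) \<longleftrightarrow>
     D \<in> Obj C \<and> e \<in> hom C D \<K> \<and> d \<in> hom C D (D \<boxtimes> D) \<and>
     (\<one> D \<otimes> e) \<cdot> d = \<one> D \<and>
     (e \<otimes> \<one> D) \<cdot> d = \<one> D \<and>
     (\<one> D \<otimes> d) \<cdot> d = (d \<otimes> \<one> D) \<cdot> d"

definition unit_coalg :: "('o, 'm) coalgebra" where
  "unit_coalg = (\<K>, \<one> \<K>, \<one> \<K>)"

fun tensor_coalg :: "('o, 'm) coalgebra \<Rightarrow> ('o, 'm) coalgebra \<Rightarrow> ('o, 'm) coalgebra" where
  "tensor_coalg (D, e, d) (E, e', d') =
     (D \<boxtimes> E, e \<otimes> e', (\<one> D \<otimes> \<c> D E \<otimes> \<one> E) \<cdot> (d \<otimes> d'))"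

fun coalg_morphism :: "('o, 'm) coalgebra \<Rightarrow> ('o, 'm) coalgebra \<Rightarrow> 'm \<Rightarrow> bool" where
  "coalg_morphism (D, e, d) (E, e', d') f \<longleftrightarrow>
     f \<in> hom C D E \<and> e' \<cdot> f = e \<and> d' \<cdot> f = (f \<otimes> f) \<cdot> d"

definition is_alg_coalg :: "('o, 'm, 'z) alg_coalg_scheme \<Rightarrow> bool" where
  "is_alg_coalg A \<longleftrightarrow> is_algebra A \<and> is_coalgebra (coalg_of A)"

text \<open>That unit and multiplication are coalgebra morphisms is, equation by equation, the same as
  counit and comultiplication being algebra morphisms.\<close>

definition is_hopf :: "('o, 'm) hopf \<Rightarrow> bool" where
  "is_hopf X \<longleftrightarrow>
     is_alg_coalg X \<and>
     coalg_morphism unit_coalg (coalg_of X) \<eta>\<^bsub>X\<^esub> \<and>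
     coalg_morphism (tensor_coalg (coalg_of X) (coalg_of X)) (coalg_of X) \<mu>\<^bsub>X\<^esub> \<and>
     antipode X \<in> hom C (carr X) (carr X) \<and>
     \<mu>\<^bsub>X\<^esub> \<cdot> (\<one> (carr X) \<otimes> antipode X) \<cdot> \<delta>\<^bsub>X\<^esub> = \<eta>\<^bsub>X\<^esub> \<cdot> \<epsilon>\<^bsub>X\<^esub> \<and>
     \<mu>\<^bsub>X\<^esub> \<cdot> (antipode X \<otimes> \<one> (carr X)) \<cdot> \<delta>\<^bsub>X\<^esub> = \<eta>\<^bsub>X\<^esub> \<cdot> \<epsilon>\<^bsub>X\<^esub>"

definition cocommutative :: "('o, 'm) hopf \<Rightarrow> bool" where
  "cocommutative X \<longleftrightarrow> \<c> (carr X) (carr X) \<cdot> \<delta>\<^bsub>X\<^esub> = \<delta>\<^bsub>X\<^esub>"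

definition left_module :: "('o, 'm, 'z) alg_coalg_scheme \<Rightarrow> 'o \<Rightarrow> 'm \<Rightarrow> bool" where
  "left_module X M \<phi> \<longleftrightarrow>
     M \<in> Obj C \<and> \<phi> \<in> hom C (carr X \<boxtimes> M) M \<and>
     \<phi> \<cdot> (\<eta>\<^bsub>X\<^esub> \<otimes> \<one> M) = \<one> M \<and>
     \<phi> \<cdot> (\<one> (carr X) \<otimes> \<phi>) = \<phi> \<cdot> (\<mu>\<^bsub>X\<^esub> \<otimes> \<one> M)"

definition left_module_morphism ::
  "('o, 'm, 'z) alg_coalg_scheme \<Rightarrow> 'o \<Rightarrow> 'm \<Rightarrow> 'o \<Rightarrow> 'm \<Rightarrow> 'm \<Rightarrow> bool" where
  "left_module_morphism X M \<phi> P \<psi> f \<longleftrightarrow>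
     f \<in> hom C M P \<and> f \<cdot> \<phi> = \<psi> \<cdot> (\<one> (carr X) \<otimes> f)"

definition module_alg_coalg ::
  "('o, 'm) hopf \<Rightarrow> ('o, 'm, 'z) alg_coalg_scheme \<Rightarrow> 'm \<Rightarrow> bool" where
  "module_alg_coalg X A \<phi> \<longleftrightarrow>
     is_hopf X \<and> is_alg_coalg A \<and>
     left_module X (carr A) \<phi> \<and>
     \<phi> \<cdot> (\<one> (carr X) \<otimes> \<eta>\<^bsub>A\<^esub>) = \<epsilon>\<^bsub>X\<^esub> \<otimes> \<eta>\<^bsub>A\<^esub> \<and>
     \<phi> \<cdot> (\<one> (carr X) \<otimes> \<mu>\<^bsub>A\<^esub>) =
       \<mu>\<^bsub>A\<^esub> \<cdot> (\<phi> \<otimes> \<phi>) \<cdot> (\<one> (carr X) \<otimes> \<c> (carr X) (carr A) \<otimes> \<one> (carr A))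
         \<cdot> (\<delta>\<^bsub>X\<^esub> \<otimes> \<one> (carr A) \<otimes> \<one> (carr A)) \<and>
     coalg_morphism (tensor_coalg (coalg_of X) (coalg_of A)) (coalg_of A) \<phi>"

section \<open>Relative Rota-Baxter operators and their modules\<close>

text \<open>The composite \<open>\<phi> \<circ> (H \<otimes> (\<psi> \<circ> (T \<otimes> M))) \<circ> (\<delta>\<^sub>H \<otimes> M)\<close> for an \<open>H\<close>-action \<open>\<phi>\<close> and a
  \<open>B\<close>-action \<open>\<psi>\<close> on \<open>M\<close>. It occurs in the Rota-Baxter equation (with \<open>M = H\<close>, \<open>\<phi> = \<mu>\<^sub>H\<close>, \<open>\<psi> = \<phi>\<^sub>H\<close>,
  where it is the second product of the associated brace), in the definition of modules, and in
  the functor \<open>U\<close>.\<close>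

definition twisted_action :: "('o, 'm) hopf \<Rightarrow> 'm \<Rightarrow> 'o \<Rightarrow> 'm \<Rightarrow> 'm \<Rightarrow> 'm" where
  "twisted_action H T M \<phi> \<psi> =
     \<phi> \<cdot> (\<one> (carr H) \<otimes> (\<psi> \<cdot> (T \<otimes> \<one> M))) \<cdot> (\<delta>\<^bsub>H\<^esub> \<otimes> \<one> M)"

definition rel_rota_baxter :: "('o, 'm) hopf \<Rightarrow> ('o, 'm) hopf \<Rightarrow> 'm \<Rightarrow> 'm \<Rightarrow> bool" where
  "rel_rota_baxter H B T \<phi>H \<longleftrightarrow>
     is_hopf H \<and> is_hopf B \<and> module_alg_coalg B H \<phi>H \<and>
     coalg_morphism (coalg_of H) (coalg_of B) T \<and>
     \<mu>\<^bsub>B\<^esub> \<cdot> (T \<otimes> T) = T \<cdot> twisted_action H T (carr H) \<mu>\<^bsub>H\<^esub> \<phi>H"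

fun rb_module ::
  "('o, 'm) hopf \<Rightarrow> ('o, 'm) hopf \<Rightarrow> 'm \<Rightarrow> 'm \<Rightarrow> ('o, 'm) rb_mod \<Rightarrow> bool" where
  "rb_module H B T \<phi>H (M, N, \<phi>M, \<psi>M, \<psi>N, \<gamma>) \<longleftrightarrow>
     left_module H M \<phi>M \<and> left_module B M \<psi>M \<and>
     \<psi>M \<cdot> (\<one> (carr B) \<otimes> \<phi>M) =
       \<phi>M \<cdot> (\<phi>H \<otimes> \<psi>M) \<cdot> (\<one> (carr B) \<otimes> \<c> (carr B) (carr H) \<otimes> \<one> M)
         \<cdot> (\<delta>\<^bsub>B\<^esub> \<otimes> \<one> (carr H) \<otimes> \<one> M) \<and>
     left_module B N \<psi>N \<and>
     \<gamma> \<in> hom C M N \<and>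
     \<psi>N \<cdot> (T \<otimes> \<gamma>) = \<gamma> \<cdot> twisted_action H T M \<phi>M \<psi>M"

fun rb_module_morphism ::
  "('o, 'm) hopf \<Rightarrow> ('o, 'm) hopf \<Rightarrow> ('o, 'm) rb_mod \<Rightarrow> ('o, 'm) rb_mod \<Rightarrow> 'm \<times> 'm \<Rightarrow> bool" where
  "rb_module_morphism H B (M, N, \<phi>M, \<psi>M, \<psi>N, \<gamma>) (P, Q, \<phi>P, \<psi>P, \<psi>Q, \<theta>) (r, s) \<longleftrightarrow>
     left_module_morphism H M \<phi>M P \<phi>P r \<and> left_module_morphism B M \<psi>M P \<psi>P r \<and>
     left_module_morphism B N \<psi>N Q \<psi>Q s \<and>
     s \<cdot> \<gamma> = \<theta> \<cdot> r"

definition rb_Mod ::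
  "('o, 'm) hopf \<Rightarrow> ('o, 'm) hopf \<Rightarrow> 'm \<Rightarrow> 'm
    \<Rightarrow> (('o, 'm) rb_mod, ('o, 'm) rb_mod \<times> ('m \<times> 'm) \<times> ('o, 'm) rb_mod) category_data" where
  "rb_Mod H B T \<phi>H =
     hom_category {X. rb_module H B T \<phi>H X} (\<lambda>X Y. {f. rb_module_morphism H B X Y f})
       (\<lambda>(M, N, \<phi>M, \<psi>M, \<psi>N, \<gamma>). (\<one> M, \<one> N))
       (\<lambda>(r', s') (r, s). (r' \<cdot> r, s' \<cdot> s))"

section \<open>Hopf braces and their modules\<close>

text \<open>\<open>Gam H M \<psi>1 \<psi>2\<close> is \<open>\<Gamma>\<^sub>M\<close>; the morphism \<open>\<Gamma>\<close> of the first Hopf algebra of a brace is the case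
  \<open>M = H\<close>, \<open>\<psi>1 = \<mu>1\<close>, \<open>\<psi>2 = \<mu>2\<close>.\<close>

definition Gam :: "('o, 'm) hopf \<Rightarrow> 'o \<Rightarrow> 'm \<Rightarrow> 'm \<Rightarrow> 'm" where
  "Gam H1 M \<psi>1 \<psi>2 = \<psi>1 \<cdot> (antipode H1 \<otimes> \<psi>2) \<cdot> (\<delta>\<^bsub>H1\<^esub> \<otimes> \<one> M)"

definition hopf_brace :: "('o, 'm) hopf \<Rightarrow> ('o, 'm) hopf \<Rightarrow> bool" where
  "hopf_brace H1 H2 \<longleftrightarrow>
     is_hopf H1 \<and> is_hopf H2 \<and> coalg_of H1 = coalg_of H2 \<and> \<eta>\<^bsub>H1\<^esub> = \<eta>\<^bsub>H2\<^esub> \<and>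
     \<mu>\<^bsub>H2\<^esub> \<cdot> (\<one> (carr H1) \<otimes> \<mu>\<^bsub>H1\<^esub>) =
       \<mu>\<^bsub>H1\<^esub> \<cdot> (\<mu>\<^bsub>H2\<^esub> \<otimes> Gam H1 (carr H1) \<mu>\<^bsub>H1\<^esub> \<mu>\<^bsub>H2\<^esub>)
         \<cdot> (\<one> (carr H1) \<otimes> \<c> (carr H1) (carr H1) \<otimes> \<one> (carr H1))
         \<cdot> (\<delta>\<^bsub>H1\<^esub> \<otimes> \<one> (carr H1) \<otimes> \<one> (carr H1))"

fun brace_module :: "('o, 'm) hopf \<Rightarrow> ('o, 'm) hopf \<Rightarrow> ('o, 'm) brace_mod \<Rightarrow> bool" where
  "brace_module H1 H2 (M, \<psi>1, \<psi>2) \<longleftrightarrow>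
     left_module H1 M \<psi>1 \<and> left_module H2 M \<psi>2 \<and>
     \<psi>2 \<cdot> (\<one> (carr H1) \<otimes> \<psi>1) =
       \<psi>1 \<cdot> (\<mu>\<^bsub>H2\<^esub> \<otimes> Gam H1 M \<psi>1 \<psi>2)
         \<cdot> (\<one> (carr H1) \<otimes> \<c> (carr H1) (carr H1) \<otimes> \<one> M)
         \<cdot> (\<delta>\<^bsub>H1\<^esub> \<otimes> \<one> (carr H1) \<otimes> \<one> M)"

fun brace_module_morphism ::
  "('o, 'm) hopf \<Rightarrow> ('o, 'm) hopf \<Rightarrow> ('o, 'm) brace_mod \<Rightarrow> ('o, 'm) brace_mod \<Rightarrow> 'm \<Rightarrow> bool" where
  "brace_module_morphism H1 H2 (M, \<psi>1, \<psi>2) (P, \<psi>1', \<psi>2') f \<longleftrightarrow>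
     left_module_morphism H1 M \<psi>1 P \<psi>1' f \<and> left_module_morphism H2 M \<psi>2 P \<psi>2' f"

definition brace_Mod ::
  "('o, 'm) hopf \<Rightarrow> ('o, 'm) hopf
    \<Rightarrow> (('o, 'm) brace_mod, ('o, 'm) brace_mod \<times> 'm \<times> ('o, 'm) brace_mod) category_data" where
  "brace_Mod H1 H2 =
     hom_category {X. brace_module H1 H2 X} (\<lambda>X Y. {f. brace_module_morphism H1 H2 X Y f})
       (\<lambda>(M, \<psi>1, \<psi>2). \<one> M) (\<cdot>)"

text \<open>The second Hopf algebra of the Hopf brace associated to a relative Rota-Baxter operator; the
  first one is \<open>H\<close> itself.\<close>

definition assoc_hopf :: "('o, 'm) hopf \<Rightarrow> ('o, 'm) hopf \<Rightarrow> 'm \<Rightarrow> 'm \<Rightarrow> ('o, 'm) hopf" where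
  "assoc_hopf H B T \<phi>H =
     H\<lparr>alg_mult := twisted_action H T (carr H) \<mu>\<^bsub>H\<^esub> \<phi>H,
       antipode := \<phi>H \<cdot> ((antipode B \<cdot> T) \<otimes> antipode H) \<cdot> \<delta>\<^bsub>H\<^esub>\<rparr>"

section \<open>The functors \<open>V\<close> and \<open>U\<close>\<close>

definition functor_V ::
  "('o, 'm) hopf \<Rightarrow> 'm
    \<Rightarrow> (('o, 'm) brace_mod, ('o, 'm) brace_mod \<times> 'm \<times> ('o, 'm) brace_mod,
        ('o, 'm) rb_mod, ('o, 'm) rb_mod \<times> ('m \<times> 'm) \<times> ('o, 'm) rb_mod) functor_data" where
  "functor_V H T =
     hom_functor
       (\<lambda>(M, \<psi>1, \<psi>2).
          (M, M, \<psi>1, Gam H M \<psi>1 \<psi>2 \<cdot> (inverse_of C T \<otimes> \<one> M), \<psi>2 \<cdot> (inverse_of C T \<otimes> \<one> M), \<one> M))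
       (\<lambda>f. (f, f))"

definition functor_U ::
  "('o, 'm) hopf \<Rightarrow> 'm
    \<Rightarrow> (('o, 'm) rb_mod, ('o, 'm) rb_mod \<times> ('m \<times> 'm) \<times> ('o, 'm) rb_mod,
        ('o, 'm) brace_mod, ('o, 'm) brace_mod \<times> 'm \<times> ('o, 'm) brace_mod) functor_data" where
  "functor_U H T =
     hom_functor
       (\<lambda>(M, N, \<phi>M, \<psi>M, \<psi>N, \<gamma>). (M, \<phi>M, twisted_action H T M \<phi>M \<psi>M))
       (\<lambda>(r, s). r)"

end

end

theory Submission
  imports Defs
begin

text \<open>As \<open>T\<close> is an isomorphism of coalgebras, the Rota-Baxter equation says that \<open>T\<close> transports \<open>B\<close> to
  the second structure \<open>H2\<close> of the brace, and \<open>B\<close>-actions become \<open>H2\<close>-actions \<open>\<psi>\<close>. For an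
  \<open>H\<close>-action \<open>\<phi>\<close> on \<open>M\<close>, convolving with the identity of \<open>H\<close> sends \<open>\<psi>\<close> to \<open>\<phi>(h\<^sub>1, \<psi>(h\<^sub>2, m))\<close>, and
  convolving with the antipode inverts this and gives \<open>\<Gamma>\<close>. Convolution by a coalgebra morphism
  into \<open>H\<close> is injective; convolving the two conditions on a module over the Rota-Baxter operator
  with \<open>id\<^sub>H\<close> and with the product of \<open>H2\<close> therefore shows that they are equivalent to the conditions
  on a brace module. A morphism \<open>(r, s)\<close> out of \<open>V(M)\<close>, whose structure map is the identity, into
  an object with structure map \<open>\<theta>\<close> satisfies \<open>s = \<theta> \<circ> r\<close>, so \<open>(r, s) \<mapsto> r\<close> is a bijection.\<close>

text \<open>In element notation, with crossings suppressed, put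
  \<open>\<theta>(h, m) = \<phi>(h1, \<psi>(h2, m))\<close> and let \<open>\<sigma>\<close> be the
  action on \<open>H\<close>, pulled back along \<open>T\<close>. Convolving \<open>\<psi>(h,
  \<phi>(x, m)) = \<phi>(\<sigma>(h1, x), \<psi>(h2, m))\<close> with the identity gives
  \<open>\<theta>(h, \<phi>(x, m)) = \<phi>(\<mu>2(h1, x), \<psi>(h2, m))\<close>, because the
  product \<open>\<mu>2\<close> of \<open>H2\<close> is the convolution of the identity with
  \<open>\<sigma>\<close>. This is the brace condition, since \<open>\<Gamma> = \<psi>\<close>.
  Associativity of \<open>\<psi>\<close> has two variables from \<open>H\<close>, and both have to
  be twisted at once; hence the convolution with \<open>\<mu>2\<close>: \<open>\<phi>(\<mu>2(h1,
  k1), \<psi>(h2, \<psi>(k2, m))) = \<theta>(h, \<phi>(k1, \<psi>(k2, m))) = \<theta>(h, \<theta>(k,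
  m))\<close>. The first equality is the convolved compatibility, so associativity is compared only
  for compatible pairs, and cancelling \<open>\<mu>2\<close> requires that it is a coalgebra
  morphism, so \<open>H2\<close> must be a Hopf algebra beforehand. The Rota-Baxter equation speaks
  of products only; that \<open>T\<close> respects units and antipodes has to be derived.\<close>

lemma in_hom_iff: "f \<in> hom C A B \<longleftrightarrow> f \<in> Arr C \<and> Dom C f = A \<and> Cod C f = B"
  by (auto simp: hom_def)

section \<open>Typing rules, composites and inverses\<close>

context category
begin

lemma Dom_Obj [simp]: "f \<in> Arr C \<Longrightarrow> Dom C f \<in> Obj C"
  and Cod_Obj [simp]: "f \<in> Arr C \<Longrightarrow> Cod C f \<in> Obj C"
  using dom_cod_obj by auto

lemma ident_simps [simp]:
  assumes "A \<in> Obj C"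
  shows "\<one> A \<in> Arr C" "Dom C (\<one> A) = A" "Cod C (\<one> A) = A"
  using ident_hom[OF assms] by (auto simp: in_hom_iff)

lemma comp_simps [simp]:
  assumes "f \<in> Arr C" "g \<in> Arr C" "Dom C g = Cod C f"
  shows "g \<cdot> f \<in> Arr C" "Dom C (g \<cdot> f) = Dom C f" "Cod C (g \<cdot> f) = Cod C g"
  using comp_hom[OF assms] by (auto simp: in_hom_iff)

lemma comp_ident_left' [simp]: "f \<in> Arr C \<Longrightarrow> Cod C f = A \<Longrightarrow> \<one> A \<cdot> f = f"
  using comp_ident_left by auto

lemma comp_ident_right' [simp]: "f \<in> Arr C \<Longrightarrow> Dom C f = A \<Longrightarrow> f \<cdot> \<one> A = f"
  using comp_ident_right by auto

lemmas [simp] = comp_assoc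

text \<open>With \<open>comp_assoc\<close> as a rewrite rule composites associate to the right, so
  \<open>g \<cdot> f\<close> is not a subterm of a longer composite. This is the form of an equation
  that still matches there.\<close>

lemma comp_extend:
  assumes "g \<cdot> f = h" "x \<in> Arr C" "f \<in> Arr C" "g \<in> Arr C" "Dom C f = Cod C x" "Dom C g = Cod C f"
  shows "g \<cdot> f \<cdot> x = h \<cdot> x"
  using assms comp_assoc by metis

lemma inverse_arrows_unique:
  assumes "inverse_arrows C f g" "inverse_arrows C f g'"
  shows "g = g'"
proof -
  have "g = (g' \<cdot> f) \<cdot> g"
    using assms by (simp add: inverse_arrows_def in_hom_iff del: comp_assoc)
  also have "\<dots> = g' \<cdot> (f \<cdot> g)"
    using assms by (intro comp_assoc) (auto simp: inverse_arrows_def in_hom_iff)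
  also have "\<dots> = g'"
    using assms by (simp add: inverse_arrows_def in_hom_iff)
  finally show ?thesis .
qed

lemma inverse_arrows_inverse_of: "isomorphism C f \<Longrightarrow> inverse_arrows C f (inverse_of C f)"
  unfolding isomorphism_def inverse_of_def
  using inverse_arrows_unique by (metis (mono_tags, lifting) theI')

end

section \<open>Adjunctions between categories presented by hom-sets\<close>

lemma hom_category_simps:
  "Obj (hom_category Ob Hm idn cmp) = Ob"
  "(X, f, Y) \<in> Arr (hom_category Ob Hm idn cmp) \<longleftrightarrow> X \<in> Ob \<and> Y \<in> Ob \<and> f \<in> Hm X Y"
  "Dom (hom_category Ob Hm idn cmp) (X, f, Y) = X"
  "Cod (hom_category Ob Hm idn cmp) (X, f, Y) = Y"
  "Ident (hom_category Ob Hm idn cmp) X = (X, idn X, X)"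
  "Comp (hom_category Ob Hm idn cmp) (Y', g, Z) (X, f, Y) = (X, cmp g f, Z)"
  by (simp_all add: hom_category_def)

lemma hom_hom_category:
  "hom (hom_category Ob Hm idn cmp) X Y = (if X \<in> Ob \<and> Y \<in> Ob then (\<lambda>f. (X, f, Y)) ` Hm X Y else {})"
  by (auto simp: hom_def hom_category_def)

locale hom_system =
  fixes Ob :: "'a set" and Hm :: "'a \<Rightarrow> 'a \<Rightarrow> 'f set" and idn :: "'a \<Rightarrow> 'f" and cmp :: "'f \<Rightarrow> 'f \<Rightarrow> 'f"
  assumes idn_hom: "X \<in> Ob \<Longrightarrow> idn X \<in> Hm X X"
    and cmp_hom: "\<lbrakk>X \<in> Ob; Y \<in> Ob; Z \<in> Ob; f \<in> Hm X Y; g \<in> Hm Y Z\<rbrakk> \<Longrightarrow> cmp g f \<in> Hm X Z"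
    and cmp_idn_left: "\<lbrakk>X \<in> Ob; Y \<in> Ob; f \<in> Hm X Y\<rbrakk> \<Longrightarrow> cmp (idn Y) f = f"
    and cmp_idn_right: "\<lbrakk>X \<in> Ob; Y \<in> Ob; f \<in> Hm X Y\<rbrakk> \<Longrightarrow> cmp f (idn X) = f"
    and cmp_assoc: "\<lbrakk>X \<in> Ob; Y \<in> Ob; Z \<in> Ob; W \<in> Ob; f \<in> Hm X Y; g \<in> Hm Y Z; k \<in> Hm Z W\<rbrakk>
      \<Longrightarrow> cmp (cmp k g) f = cmp k (cmp g f)"
begin

lemma category: "category (hom_category Ob Hm idn cmp)"
  by unfold_locales
    (auto simp: hom_category_simps in_hom_iff idn_hom cmp_idn_left cmp_idn_right
      intro: cmp_hom cmp_assoc)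

end

text \<open>As \<open>\<gamma>\<close> respects composites and
  \<open>\<gamma> (\<phi> f) = f\<close>, the map \<open>\<gamma>\<close> is natural by itself, and
  only its bijectivity on each hom-set has to be supplied. \<open>F_cmp\<close>,
  \<open>G_cmp\<close> and \<open>G_F\<close> can be required of all arguments because in the
  application \<open>\<phi>\<close> is the diagonal and \<open>\<gamma>\<close> the first
  projection.\<close>

locale hom_adjunction =
  V: hom_system Ob1 Hm1 idn1 cmp1 + U: hom_system Ob2 Hm2 idn2 cmp2
  for Ob1 :: "'a set" and Hm1 :: "'a \<Rightarrow> 'a \<Rightarrow> 'f set" and idn1 cmp1
    and Ob2 :: "'b set" and Hm2 :: "'b \<Rightarrow> 'b \<Rightarrow> 'g set" and idn2 cmp2 +
  fixes F :: "'a \<Rightarrow> 'b" and \<phi> :: "'f \<Rightarrow> 'g" and G :: "'b \<Rightarrow> 'a" and \<gamma> :: "'g \<Rightarrow> 'f"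
  assumes F_obj: "X \<in> Ob1 \<Longrightarrow> F X \<in> Ob2"
    and F_hom: "\<lbrakk>X \<in> Ob1; Y \<in> Ob1; f \<in> Hm1 X Y\<rbrakk> \<Longrightarrow> \<phi> f \<in> Hm2 (F X) (F Y)"
    and F_idn: "X \<in> Ob1 \<Longrightarrow> \<phi> (idn1 X) = idn2 (F X)"
    and F_cmp: "\<phi> (cmp1 g f) = cmp2 (\<phi> g) (\<phi> f)"
    and G_obj: "P \<in> Ob2 \<Longrightarrow> G P \<in> Ob1"
    and G_hom: "\<lbrakk>P \<in> Ob2; Q \<in> Ob2; k \<in> Hm2 P Q\<rbrakk> \<Longrightarrow> \<gamma> k \<in> Hm1 (G P) (G Q)"
    and G_idn: "P \<in> Ob2 \<Longrightarrow> \<gamma> (idn2 P) = idn1 (G P)"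
    and G_cmp: "\<gamma> (cmp2 l k) = cmp1 (\<gamma> l) (\<gamma> k)"
    and G_F: "\<gamma> (\<phi> f) = f"
    and bij: "\<lbrakk>X \<in> Ob1; P \<in> Ob2\<rbrakk> \<Longrightarrow> bij_betw \<gamma> (Hm2 (F X) P) (Hm1 X (G P))"
begin

lemma left_adjoint:
  "left_adjoint (hom_category Ob1 Hm1 idn1 cmp1) (hom_category Ob2 Hm2 idn2 cmp2)
    (hom_functor F \<phi>) (hom_functor G \<gamma>)"
proof -
  let ?C = "hom_category Ob1 Hm1 idn1 cmp1" and ?D = "hom_category Ob2 Hm2 idn2 cmp2"
  have "is_functor ?C ?D (hom_functor F \<phi>)"
    using V.category U.category
    by (auto simp: is_functor_def is_functor_axioms_def hom_functor_def hom_category_simps in_hom_iff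
        F_obj F_hom F_idn F_cmp)
  moreover have "is_functor ?D ?C (hom_functor G \<gamma>)"
    using V.category U.category
    by (auto simp: is_functor_def is_functor_axioms_def hom_functor_def hom_category_simps in_hom_iff
        G_obj G_hom G_idn G_cmp)
  \<comment> \<open>The source of the new arrow is set to \<open>X\<close>. Applying the functor to
    the arrow would give the source \<open>G (F X)\<close>, which the locale does not identify with
    \<open>X\<close>.\<close>
  moreover have "bij_betw (\<lambda>(_, f, _). (X, \<gamma> f, G P)) (hom ?D (F X) P) (hom ?C X (G P))"
    if "X \<in> Ob1" "P \<in> Ob2" for X P
    using bij[OF that] that
    by (auto simp: hom_hom_category F_obj G_obj bij_betw_def inj_on_def image_iff) blast
  moreover have "\<gamma> (cmp2 g (cmp2 k (\<phi> f))) = cmp1 (\<gamma> g) (cmp1 (\<gamma> k) f)" for g k f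
    by (simp add: G_cmp G_F)
  ultimately show ?thesis
    unfolding left_adjoint_def
    by (intro conjI exI[of _ "\<lambda>X P (_, f, _). (X, \<gamma> f, G P)"])
      (auto simp: hom_category_simps hom_hom_category hom_functor_def)
qed

end

section \<open>Whiskering and a normal form for composites of tensor products\<close>

context strict_braided_monoidal_category
begin

lemmas [simp] = unit_obj tensor_obj tensor_obj_assoc tensor_ident

lemma tensor_obj_unit_simps [simp]:
  "P \<in> Obj C \<Longrightarrow> \<K> \<boxtimes> P = P" "P \<in> Obj C \<Longrightarrow> P \<boxtimes> \<K> = P"
  using tensor_obj_unit by auto

lemma tensor_arr_unit_simps [simp]:
  "f \<in> Arr C \<Longrightarrow> \<one> \<K> \<otimes> f = f" "f \<in> Arr C \<Longrightarrow> f \<otimes> \<one> \<K> = f"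
  using tensor_arr_unit by auto

lemma tensor_simps [simp]:
  assumes "f \<in> Arr C" "g \<in> Arr C"
  shows "f \<otimes> g \<in> Arr C" "Dom C (f \<otimes> g) = Dom C f \<boxtimes> Dom C g" "Cod C (f \<otimes> g) = Cod C f \<boxtimes> Cod C g"
  using tensor_arr[OF assms] by (auto simp: in_hom_iff)

lemma braid_simps [simp]:
  assumes "P \<in> Obj C" "Q \<in> Obj C"
  shows "\<c> P Q \<in> Arr C" "Dom C (\<c> P Q) = P \<boxtimes> Q" "Cod C (\<c> P Q) = Q \<boxtimes> P"
  using braid_hom[OF assms] by (auto simp: in_hom_iff)

definition lwhisk :: "'o \<Rightarrow> 'm \<Rightarrow> 'm"  (infixr \<open>\<lhd>\<close> 72) where
  "A \<lhd> f = \<one> A \<otimes> f"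

definition rwhisk :: "'m \<Rightarrow> 'o \<Rightarrow> 'm"  (infixl \<open>\<rhd>\<close> 73) where
  "f \<rhd> A = f \<otimes> \<one> A"

lemma whisk_simps [simp]:
  assumes "A \<in> Obj C" "f \<in> Arr C"
  shows "A \<lhd> f \<in> Arr C" "Dom C (A \<lhd> f) = A \<boxtimes> Dom C f" "Cod C (A \<lhd> f) = A \<boxtimes> Cod C f"
    "f \<rhd> A \<in> Arr C" "Dom C (f \<rhd> A) = Dom C f \<boxtimes> A" "Cod C (f \<rhd> A) = Cod C f \<boxtimes> A"
  using assms by (auto simp: lwhisk_def rwhisk_def)

lemma tensor_whisk:
  assumes "f \<in> Arr C" "g \<in> Arr C"
  shows "f \<otimes> g = f \<rhd> Cod C g \<cdot> Dom C f \<lhd> g"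
  using assms by (simp add: lwhisk_def rwhisk_def interchange[symmetric])

lemma whisk_ident:
  assumes "A \<in> Obj C" "B \<in> Obj C"
  shows "A \<lhd> \<one> B = \<one> (A \<boxtimes> B)" "\<one> A \<rhd> B = \<one> (A \<boxtimes> B)"
  using assms by (auto simp: lwhisk_def rwhisk_def)

lemma whisk_comp:
  assumes "A \<in> Obj C" "f \<in> Arr C" "g \<in> Arr C" "Dom C g = Cod C f"
  shows "A \<lhd> (g \<cdot> f) = A \<lhd> g \<cdot> A \<lhd> f" "(g \<cdot> f) \<rhd> A = g \<rhd> A \<cdot> f \<rhd> A"
  using assms by (auto simp: lwhisk_def rwhisk_def interchange[symmetric])

lemma whisk_whisk:
  assumes "A \<in> Obj C" "B \<in> Obj C" "f \<in> Arr C"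
  shows "A \<lhd> (B \<lhd> f) = (A \<boxtimes> B) \<lhd> f" "f \<rhd> A \<rhd> B = f \<rhd> (A \<boxtimes> B)" "(A \<lhd> f) \<rhd> B = A \<lhd> (f \<rhd> B)"
  using assms tensor_ident[of A B, symmetric] by (auto simp: lwhisk_def rwhisk_def tensor_arr_assoc simp del: tensor_ident)

lemma whisk_unit: "f \<in> Arr C \<Longrightarrow> \<K> \<lhd> f = f" "f \<in> Arr C \<Longrightarrow> f \<rhd> \<K> = f"
  by (auto simp: lwhisk_def rwhisk_def)

text \<open>The interchange law for morphisms on disjoint strands: \<open>f\<close> on the left,
  \<open>x\<close> on the right, \<open>X\<close> between them and \<open>L\<close> to the left of
  both. \<open>F\<close> and \<open>R\<close> are variables tied down by equations, so that the
  left-hand side still matches after the codomain of \<open>f\<close> and the domain of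
  \<open>x\<close> have been simplified.\<close>

lemma exchange:
  assumes "L \<in> Obj C" "X \<in> Obj C" "x \<in> Arr C" "f \<in> Arr C" "Cod C f = F" "R = X \<boxtimes> Dom C x"
  shows "(L \<boxtimes> F \<boxtimes> X) \<lhd> x \<cdot> L \<lhd> (f \<rhd> R) = L \<lhd> (f \<rhd> (X \<boxtimes> Cod C x)) \<cdot> (L \<boxtimes> Dom C f \<boxtimes> X) \<lhd> x"
proof -
  have 1: "A \<lhd> y \<cdot> g \<rhd> Dom C y = g \<rhd> Cod C y \<cdot> Dom C g \<lhd> y"
    if "g \<in> Arr C" "y \<in> Arr C" "Cod C g = A" for A y g
    using that by (auto simp add: lwhisk_def rwhisk_def interchange[symmetric])
  have F: "F \<in> Obj C" using assms by auto
  have "(L \<boxtimes> F \<boxtimes> X) \<lhd> x \<cdot> L \<lhd> (f \<rhd> R) = L \<lhd> (F \<lhd> (X \<lhd> x) \<cdot> f \<rhd> Dom C (X \<lhd> x))"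
    using assms F by (simp add: whisk_comp whisk_whisk)
  also have "\<dots> = L \<lhd> (f \<rhd> Cod C (X \<lhd> x) \<cdot> Dom C f \<lhd> (X \<lhd> x))"
    using assms F by (subst 1) auto
  also have "\<dots> = L \<lhd> (f \<rhd> (X \<boxtimes> Cod C x)) \<cdot> (L \<boxtimes> Dom C f \<boxtimes> X) \<lhd> x"
    using assms F by (simp add: whisk_comp whisk_whisk)
  finally show ?thesis .
qed

lemma exchange_extend:
  assumes "L \<in> Obj C" "X \<in> Obj C" "x \<in> Arr C" "f \<in> Arr C" "Cod C f = F" "R = X \<boxtimes> Dom C x"
    "y \<in> Arr C" "Cod C y = L \<boxtimes> Dom C f \<boxtimes> R"
  shows "(L \<boxtimes> F \<boxtimes> X) \<lhd> x \<cdot> L \<lhd> (f \<rhd> R) \<cdot> y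
    = L \<lhd> (f \<rhd> (X \<boxtimes> Cod C x)) \<cdot> (L \<boxtimes> Dom C f \<boxtimes> X) \<lhd> x \<cdot> y"
proof -
  have "F \<in> Obj C" using assms by auto
  then show ?thesis
    using assms comp_extend[OF exchange[OF assms(1-6)], of y] by simp
qed

text \<open>Composites of tensor products are normalised by moving the morphism on the right before the one
  on the left. Matching is syntactic, so the objects to the left of, produced by, and between the
  exchanged morphisms have to be spelled out factor by factor.\<close>

lemma exchange_slices:
  assumes "x \<in> Arr C" "f \<in> Arr C" "Cod C f = F" "R = Dom C x"
  shows "F \<lhd> x \<cdot> f \<rhd> R = f \<rhd> Cod C x \<cdot> Dom C f \<lhd> x"
  using assms exchange[of \<K> \<K> x f F R] by (auto simp: whisk_unit)

lemma exchange_slices_extend: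
  assumes "x \<in> Arr C" "f \<in> Arr C" "y \<in> Arr C"
  shows
    "\<lbrakk>F \<in> Obj C; Cod C f = F; R = Dom C x; Cod C y = Dom C f \<boxtimes> R\<rbrakk> \<Longrightarrow>
      F \<lhd> x \<cdot> f \<rhd> R \<cdot> y
      = f \<rhd> Cod C x \<cdot> Dom C f \<lhd> x \<cdot> y"
    "\<lbrakk>F \<in> Obj C; X \<in> Obj C; Cod C f = F; R = X \<boxtimes> Dom C x; Cod C y = Dom C f \<boxtimes> R\<rbrakk> \<Longrightarrow>
      (F \<boxtimes> X) \<lhd> x \<cdot> f \<rhd> R \<cdot> y
      = f \<rhd> (X \<boxtimes> Cod C x) \<cdot> (Dom C f \<boxtimes> X) \<lhd> x \<cdot> y"
    "\<lbrakk>F1 \<in> Obj C; F2 \<in> Obj C; X \<in> Obj C; Cod C f = F1 \<boxtimes> F2; R = X \<boxtimes> Dom C x; Cod C y = Dom C f \<boxtimes> R\<rbrakk> \<Longrightarrow>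
      (F1 \<boxtimes> F2 \<boxtimes> X) \<lhd> x \<cdot> f \<rhd> R \<cdot> y
      = f \<rhd> (X \<boxtimes> Cod C x) \<cdot> (Dom C f \<boxtimes> X) \<lhd> x \<cdot> y"
    "\<lbrakk>L \<in> Obj C; F \<in> Obj C; Cod C f = F; R = Dom C x; Cod C y = L \<boxtimes> Dom C f \<boxtimes> R\<rbrakk> \<Longrightarrow>
      (L \<boxtimes> F) \<lhd> x \<cdot> L \<lhd> (f \<rhd> R) \<cdot> y
      = L \<lhd> (f \<rhd> Cod C x) \<cdot> (L \<boxtimes> Dom C f) \<lhd> x \<cdot> y"
  subgoal using assms exchange_extend[of \<K> \<K> x f F R y] by (simp add: whisk_whisk whisk_unit)
  subgoal using assms exchange_extend[of \<K> X x f F R y] by (simp add: whisk_whisk whisk_unit)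
  subgoal using assms exchange_extend[of \<K> X x f "F1 \<boxtimes> F2" R y] by (simp add: whisk_whisk whisk_unit)
  subgoal using assms exchange_extend[of L \<K> x f F R y] by (simp add: whisk_whisk whisk_unit)
  done

text \<open>Not among the rewrite rules in general: with a variable \<open>x\<close> or \<open>f\<close> in place of a whiskered
  morphism they match every composite.\<close>

lemma exchange_counit:
  assumes "x \<in> Arr C" "f \<in> Arr C" "Cod C f = \<K>" "R = Dom C x"
  shows "x \<cdot> f \<rhd> R = f \<rhd> Cod C x \<cdot> Dom C f \<lhd> x"
    "\<lbrakk>y \<in> Arr C; Cod C y = Dom C f \<boxtimes> R\<rbrakk> \<Longrightarrow> x \<cdot> f \<rhd> R \<cdot> y = f \<rhd> Cod C x \<cdot> Dom C f \<lhd> x \<cdot> y"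
  using assms exchange[of \<K> \<K> x f \<K> R] exchange_extend[of \<K> \<K> x f \<K> R y] by (simp_all add: whisk_unit)

lemma exchange_unit:
  assumes "x \<in> Arr C" "f \<in> Arr C" "Cod C f = F" "Dom C x = \<K>"
  shows "F \<lhd> x \<cdot> f = f \<rhd> Cod C x \<cdot> Dom C f \<lhd> x"
    "\<lbrakk>y \<in> Arr C; Cod C y = Dom C f\<rbrakk> \<Longrightarrow> F \<lhd> x \<cdot> f \<cdot> y = f \<rhd> Cod C x \<cdot> Dom C f \<lhd> x \<cdot> y"
  using assms exchange[of \<K> \<K> x f F \<K>] exchange_extend[of \<K> \<K> x f F \<K> y] by (auto simp: whisk_unit)

text \<open>Rewriting with this set yields a composite of slices, each applying one morphism and
  leaving the other strands alone. Laws of algebras, coalgebras and the braiding are left out: a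
  calculation parenthesises a composite so that one side of such a law is a literal subterm, unfolds
  the law, and normalises again.\<close>

lemmas slice = tensor_whisk whisk_ident whisk_comp whisk_whisk whisk_unit exchange_slices exchange_slices_extend

section \<open>Braiding with the unit object, tensor products of coalgebras, convolution\<close>

lemma idempotent_iso_ident:
  assumes "isomorphism C f" "f \<cdot> f = f" "Dom C f = Cod C f"
  shows "f = \<one> (Cod C f)"
proof -
  obtain g where g: "inverse_arrows C f g"
    using assms by (auto simp: isomorphism_def)
  then have "f = g \<cdot> f \<cdot> f"
    using assms comp_assoc[of f f g] by (auto simp: inverse_arrows_def in_hom_iff simp del: comp_assoc)
  then show ?thesis
    using assms g by (simp add: inverse_arrows_def)
qed

text \<open>With two unit objects the hexagon axiom reads
  \<open>\<c> \<K> P = \<c> \<K> P \<cdot> \<c> \<K> P\<close>, and an invertible idempotent is an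
  identity.\<close>

lemma braid_unit_left: "P \<in> Obj C \<Longrightarrow> \<c> \<K> P = \<one> P"
  using braid_tensor_left[of \<K> \<K> P] idempotent_iso_ident[OF braid_iso, of \<K> P] by simp

lemma braid_unit_right: "P \<in> Obj C \<Longrightarrow> \<c> P \<K> = \<one> P"
  using braid_tensor_right[of P \<K> \<K>] idempotent_iso_ident[OF braid_iso, of P \<K>] by simp

text \<open>Convolution with the product of \<open>H2\<close> takes place over the coalgebra
  \<open>h \<boxtimes> h\<close>, which is why this is needed. The equations \<open>nat\<close>
  slide counits and comultiplications through a crossing; for comultiplications, naturality is
  combined with a hexagon axiom.\<close>

lemma is_coalgebra_tensor:
  assumes "is_coalgebra (D, e, d)" "is_coalgebra (E, e', d')"
  shows "is_coalgebra (tensor_coalg (D, e, d) (E, e', d'))"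
proof -
  have [simp]: "D \<in> Obj C" "e \<in> Arr C" "Dom C e = D" "Cod C e = \<K>" "d \<in> Arr C" "Dom C d = D" "Cod C d = D \<boxtimes> D"
    "E \<in> Obj C" "e' \<in> Arr C" "Dom C e' = E" "Cod C e' = \<K>" "d' \<in> Arr C" "Dom C d' = E" "Cod C d' = E \<boxtimes> E"
    using assms by (auto simp: in_hom_iff)
  have laws: "(\<one> D \<otimes> e) \<cdot> d = \<one> D" "(e \<otimes> \<one> D) \<cdot> d = \<one> D" "(\<one> D \<otimes> d) \<cdot> d = (d \<otimes> \<one> D) \<cdot> d"
    "(\<one> E \<otimes> e') \<cdot> d' = \<one> E" "(e' \<otimes> \<one> E) \<cdot> d' = \<one> E" "(\<one> E \<otimes> d') \<cdot> d' = (d' \<otimes> \<one> E) \<cdot> d'"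
    using assms by auto
  let ?d = "(\<one> D \<otimes> \<c> D E \<otimes> \<one> E) \<cdot> (d \<otimes> d')"
  have nat: "(\<one> E \<otimes> e) \<cdot> \<c> D E = e \<otimes> \<one> E" "(e' \<otimes> \<one> D) \<cdot> \<c> D E = \<one> D \<otimes> e'"
    "(\<one> E \<otimes> d) \<cdot> \<c> D E = (\<c> D E \<otimes> \<one> D) \<cdot> (\<one> D \<otimes> \<c> D E) \<cdot> (d \<otimes> \<one> E)"
    "(d' \<otimes> \<one> D) \<cdot> \<c> D E = (\<one> E \<otimes> \<c> D E) \<cdot> (\<c> D E \<otimes> \<one> E) \<cdot> (\<one> D \<otimes> d')"
    using braid_natural[of e "\<one> E"] braid_natural[of "\<one> D" e'] braid_natural[of d "\<one> E"] braid_natural[of "\<one> D" d']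
    by (simp_all add: braid_unit_left braid_unit_right braid_tensor_left braid_tensor_right)
  have "((\<one> D \<otimes> \<one> E) \<otimes> e \<otimes> e') \<cdot> ?d = (\<one> D \<otimes> ((\<one> E \<otimes> e) \<cdot> \<c> D E) \<otimes> e') \<cdot> (d \<otimes> d')"
    by (simp add: slice)
  also have "\<dots> = ((\<one> D \<otimes> e) \<cdot> d) \<otimes> ((\<one> E \<otimes> e') \<cdot> d')"
    unfolding nat by (simp add: slice exchange_counit)
  finally have 1: "((\<one> D \<otimes> \<one> E) \<otimes> e \<otimes> e') \<cdot> ?d = \<one> (D \<boxtimes> E)"
    unfolding laws by simp
  have "((e \<otimes> e') \<otimes> (\<one> D \<otimes> \<one> E)) \<cdot> ?d = (e \<otimes> ((e' \<otimes> \<one> D) \<cdot> \<c> D E) \<otimes> \<one> E) \<cdot> (d \<otimes> d')"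
    by (simp add: slice)
  also have "\<dots> = ((e \<otimes> \<one> D) \<cdot> d) \<otimes> ((e' \<otimes> \<one> E) \<cdot> d')"
    unfolding nat by (simp add: slice exchange_counit)
  finally have 2: "((e \<otimes> e') \<otimes> (\<one> D \<otimes> \<one> E)) \<cdot> ?d = \<one> (D \<boxtimes> E)"
    unfolding laws by simp
  have "((\<one> D \<otimes> \<one> E) \<otimes> ?d) \<cdot> ?d
    = (\<one> D \<otimes> \<one> E \<otimes> \<one> D \<otimes> \<c> D E \<otimes> \<one> E) \<cdot> (\<one> D \<otimes> ((\<one> E \<otimes> d) \<cdot> \<c> D E) \<otimes> d') \<cdot> (d \<otimes> d')"
    by (simp add: slice)
  also have "\<dots> = (\<one> D \<otimes> \<one> E \<otimes> \<one> D \<otimes> \<c> D E \<otimes> \<one> E) \<cdot> (\<one> D \<otimes> ((\<c> D E \<otimes> \<one> D) \<cdot> (\<one> D \<otimes> \<c> D E)) \<otimes> \<one> E \<otimes> \<one> E)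
    \<cdot> (((\<one> D \<otimes> d) \<cdot> d) \<otimes> ((\<one> E \<otimes> d') \<cdot> d'))"
    unfolding nat by (simp add: slice)
  \<comment> \<open>Besides coassociativity in both factors, the two sides differ in the order of
    two crossings: second \<open>D\<close> with first \<open>E\<close>, and third \<open>D\<close>
    with second \<open>E\<close>. These lie on disjoint strands and therefore commute.\<close>
  also have "\<dots> = (\<one> D \<otimes> \<c> D E \<otimes> \<one> E \<otimes> \<one> D \<otimes> \<one> E) \<cdot> (\<one> D \<otimes> \<one> D \<otimes> ((\<one> E \<otimes> \<c> D E) \<cdot> (\<c> D E \<otimes> \<one> E)) \<otimes> \<one> E)
    \<cdot> (((d \<otimes> \<one> D) \<cdot> d) \<otimes> ((d' \<otimes> \<one> E) \<cdot> d'))"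
    unfolding laws by (simp add: slice)
  also have "\<dots> = (\<one> D \<otimes> \<c> D E \<otimes> \<one> E \<otimes> \<one> D \<otimes> \<one> E) \<cdot> (d \<otimes> ((d' \<otimes> \<one> D) \<cdot> \<c> D E) \<otimes> \<one> E) \<cdot> (d \<otimes> d')"
    unfolding nat by (simp add: slice)
  also have "\<dots> = (?d \<otimes> (\<one> D \<otimes> \<one> E)) \<cdot> ?d"
    by (simp add: slice)
  finally show ?thesis
    using 1 2 by (simp add: in_hom_iff)
qed

text \<open>The convolution action of \<open>f : E \<rightarrow> X\<close> on \<open>g : E \<otimes> Y \<rightarrow> M\<close>, where \<open>\<phi> : X \<otimes> M \<rightarrow> M\<close>.
  Both \<open>twisted_action\<close> (with \<open>f\<close> the identity) and \<open>Gam\<close> (with \<open>f\<close> the antipode) are of this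
  form, so they are inverse to each other.\<close>

definition convolve :: "'m \<Rightarrow> 'm \<Rightarrow> 'o \<Rightarrow> 'm \<Rightarrow> 'm \<Rightarrow> 'm" where
  "convolve \<phi> d Y f g = \<phi> \<cdot> (f \<otimes> g) \<cdot> (d \<otimes> \<one> Y)"

lemma left_module_morphism_comp:
  assumes "left_module X M \<phi>" "left_module X P \<psi>" "left_module X Q \<chi>" "carr X \<in> Obj C"
    and f: "left_module_morphism X M \<phi> P \<psi> f" and g: "left_module_morphism X P \<psi> Q \<chi> g"
  shows "left_module_morphism X M \<phi> Q \<chi> (g \<cdot> f)"
proof -
  have [simp]: "carr X \<in> Obj C" "\<phi> \<in> Arr C" "Dom C \<phi> = carr X \<boxtimes> M" "Cod C \<phi> = M"
    "\<psi> \<in> Arr C" "Dom C \<psi> = carr X \<boxtimes> P" "Cod C \<psi> = P" "\<chi> \<in> Arr C" "Dom C \<chi> = carr X \<boxtimes> Q" "Cod C \<chi> = Q"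
    "f \<in> Arr C" "Dom C f = M" "Cod C f = P" "g \<in> Arr C" "Dom C g = P" "Cod C g = Q"
    using assms by (auto simp: left_module_def left_module_morphism_def in_hom_iff)
  have lin: "f \<cdot> \<phi> = \<psi> \<cdot> (\<one> (carr X) \<otimes> f)" "g \<cdot> \<psi> = \<chi> \<cdot> (\<one> (carr X) \<otimes> g)"
    using f g by (auto simp: left_module_morphism_def)
  have "(g \<cdot> f) \<cdot> \<phi> = (g \<cdot> \<psi>) \<cdot> (\<one> (carr X) \<otimes> f)"
    by (simp add: lin(1))
  also have "\<dots> = \<chi> \<cdot> (\<one> (carr X) \<otimes> (g \<cdot> f))"
    unfolding lin by (simp add: interchange[symmetric])
  finally show ?thesis
    by (simp add: left_module_morphism_def in_hom_iff)
qed

text \<open>One argument for two operations: with \<open>a\<close> the antipode it gives naturality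
  of \<open>\<Gamma>\<close>, with \<open>a\<close> the identity that of the twisted action.\<close>

lemma convolve_natural:
  assumes M: "left_module X M \<phi>" and P: "left_module X P \<phi>'" and f: "left_module_morphism X M \<phi> P \<phi>' f"
    and d: "d \<in> hom C D (E \<boxtimes> E)" and a: "a \<in> hom C E (carr X)" and "E \<in> Obj C"
    and g: "g \<in> hom C (E \<boxtimes> M) M" and g': "g' \<in> hom C (E \<boxtimes> P) P" and lin: "f \<cdot> g = g' \<cdot> (\<one> E \<otimes> f)"
  shows "f \<cdot> convolve \<phi> d M a g = convolve \<phi>' d P a g' \<cdot> (\<one> D \<otimes> f)"
proof -
  have [simp]: "a \<in> Arr C" "Dom C a = E" "Cod C a = carr X" "E \<in> Obj C"
    using a \<open>E \<in> Obj C\<close> by (auto simp: in_hom_iff)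
  then have [simp]: "carr X \<in> Obj C"
    by (metis Cod_Obj)
  have [simp]: "d \<in> Arr C" "Dom C d = D" "Cod C d = E \<boxtimes> E"
    using d by (auto simp: in_hom_iff)
  then have [simp]: "D \<in> Obj C"
    by (metis Dom_Obj)
  have [simp]: "\<phi> \<in> Arr C" "Dom C \<phi> = carr X \<boxtimes> M" "Cod C \<phi> = M" "M \<in> Obj C"
    "\<phi>' \<in> Arr C" "Dom C \<phi>' = carr X \<boxtimes> P" "Cod C \<phi>' = P" "P \<in> Obj C"
    "f \<in> Arr C" "Dom C f = M" "Cod C f = P"
    "g \<in> Arr C" "Dom C g = E \<boxtimes> M" "Cod C g = M" "g' \<in> Arr C" "Dom C g' = E \<boxtimes> P" "Cod C g' = P"
    using M P f g g' by (auto simp: left_module_def left_module_morphism_def in_hom_iff)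
  have "f \<cdot> convolve \<phi> d M a g = (f \<cdot> \<phi>) \<cdot> (a \<otimes> g) \<cdot> (d \<otimes> \<one> M)"
    by (simp add: convolve_def)
  also have "f \<cdot> \<phi> = \<phi>' \<cdot> (\<one> (carr X) \<otimes> f)"
    using f by (simp add: left_module_morphism_def)
  also have "(\<phi>' \<cdot> (\<one> (carr X) \<otimes> f)) \<cdot> (a \<otimes> g) \<cdot> (d \<otimes> \<one> M) = \<phi>' \<cdot> (a \<otimes> (f \<cdot> g)) \<cdot> (d \<otimes> \<one> M)"
    by (simp add: slice)
  also have "\<dots> = convolve \<phi>' d P a g' \<cdot> (\<one> D \<otimes> f)"
    unfolding lin convolve_def by (simp add: slice)
  finally show ?thesis .
qed

end

section \<open>Convolution over a Hopf algebra\<close>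

locale hopf_algebra = strict_braided_monoidal_category C
  for C :: "('o, 'm) braided_data" (structure) +
  fixes H :: "('o, 'm) hopf"
  assumes hopf: "is_hopf H"
begin

abbreviation "h \<equiv> carr H"

lemma hopf_types [simp]:
  "h \<in> Obj C"
  "\<eta>\<^bsub>H\<^esub> \<in> Arr C" "Dom C \<eta>\<^bsub>H\<^esub> = \<K>" "Cod C \<eta>\<^bsub>H\<^esub> = h"
  "\<mu>\<^bsub>H\<^esub> \<in> Arr C" "Dom C \<mu>\<^bsub>H\<^esub> = h \<boxtimes> h" "Cod C \<mu>\<^bsub>H\<^esub> = h"
  "\<epsilon>\<^bsub>H\<^esub> \<in> Arr C" "Dom C \<epsilon>\<^bsub>H\<^esub> = h" "Cod C \<epsilon>\<^bsub>H\<^esub> = \<K>"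
  "\<delta>\<^bsub>H\<^esub> \<in> Arr C" "Dom C \<delta>\<^bsub>H\<^esub> = h" "Cod C \<delta>\<^bsub>H\<^esub> = h \<boxtimes> h"
  "antipode H \<in> Arr C" "Dom C (antipode H) = h" "Cod C (antipode H) = h"
  using hopf unfolding is_hopf_def is_alg_coalg_def is_algebra_def coalg_of_def
  by (auto simp: in_hom_iff)

lemma alg_laws:
  "\<mu>\<^bsub>H\<^esub> \<cdot> (\<one> h \<otimes> \<eta>\<^bsub>H\<^esub>) = \<one> h"
  "\<mu>\<^bsub>H\<^esub> \<cdot> (\<eta>\<^bsub>H\<^esub> \<otimes> \<one> h) = \<one> h"
  "\<mu>\<^bsub>H\<^esub> \<cdot> (\<one> h \<otimes> \<mu>\<^bsub>H\<^esub>) = \<mu>\<^bsub>H\<^esub> \<cdot> (\<mu>\<^bsub>H\<^esub> \<otimes> \<one> h)"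
  using hopf unfolding is_hopf_def is_alg_coalg_def is_algebra_def by blast+

lemma coalg: "is_coalgebra (h, \<epsilon>\<^bsub>H\<^esub>, \<delta>\<^bsub>H\<^esub>)"
  using hopf unfolding is_hopf_def is_alg_coalg_def coalg_of_def by blast

lemma coalg_laws:
  "(\<one> h \<otimes> \<epsilon>\<^bsub>H\<^esub>) \<cdot> \<delta>\<^bsub>H\<^esub> = \<one> h"
  "(\<epsilon>\<^bsub>H\<^esub> \<otimes> \<one> h) \<cdot> \<delta>\<^bsub>H\<^esub> = \<one> h"
  "(\<one> h \<otimes> \<delta>\<^bsub>H\<^esub>) \<cdot> \<delta>\<^bsub>H\<^esub> = (\<delta>\<^bsub>H\<^esub> \<otimes> \<one> h) \<cdot> \<delta>\<^bsub>H\<^esub>"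
  using coalg by auto

lemma antipode_laws:
  "\<mu>\<^bsub>H\<^esub> \<cdot> (\<one> h \<otimes> antipode H) \<cdot> \<delta>\<^bsub>H\<^esub> = \<eta>\<^bsub>H\<^esub> \<cdot> \<epsilon>\<^bsub>H\<^esub>"
  "\<mu>\<^bsub>H\<^esub> \<cdot> (antipode H \<otimes> \<one> h) \<cdot> \<delta>\<^bsub>H\<^esub> = \<eta>\<^bsub>H\<^esub> \<cdot> \<epsilon>\<^bsub>H\<^esub>"
  using hopf unfolding is_hopf_def by blast+

lemma unit_coalg_laws:
  "\<epsilon>\<^bsub>H\<^esub> \<cdot> \<eta>\<^bsub>H\<^esub> = \<one> \<K>" "\<delta>\<^bsub>H\<^esub> \<cdot> \<eta>\<^bsub>H\<^esub> = \<eta>\<^bsub>H\<^esub> \<otimes> \<eta>\<^bsub>H\<^esub>"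
  using hopf unfolding is_hopf_def unit_coalg_def coalg_of_def by auto

lemma mult_coalg_laws:
  "\<epsilon>\<^bsub>H\<^esub> \<cdot> \<mu>\<^bsub>H\<^esub> = \<epsilon>\<^bsub>H\<^esub> \<otimes> \<epsilon>\<^bsub>H\<^esub>"
  "\<delta>\<^bsub>H\<^esub> \<cdot> \<mu>\<^bsub>H\<^esub> = (\<mu>\<^bsub>H\<^esub> \<otimes> \<mu>\<^bsub>H\<^esub>) \<cdot> (\<one> h \<otimes> \<c> h h \<otimes> \<one> h) \<cdot> (\<delta>\<^bsub>H\<^esub> \<otimes> \<delta>\<^bsub>H\<^esub>)"
  using hopf unfolding is_hopf_def coalg_of_def by auto

text \<open>Morphisms from \<open>D\<close> to \<open>h\<close> form a monoid under convolution, and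
  this monoid acts on morphisms from \<open>D \<boxtimes> Y\<close> to \<open>M\<close>:
  associativity of \<open>\<phi>\<close> is played against coassociativity of
  \<open>d\<close>.\<close>

lemma left_module_convolve_assoc:
  assumes M: "left_module H M \<phi>" and D: "is_coalgebra (D, e, d)"
    and f: "f \<in> hom C D h" and f': "f' \<in> hom C D h" and g: "g \<in> hom C (D \<boxtimes> Y) M" and Y: "Y \<in> Obj C"
  shows "convolve \<phi> d Y f (convolve \<phi> d Y f' g) = convolve \<phi> d Y (\<mu>\<^bsub>H\<^esub> \<cdot> (f \<otimes> f') \<cdot> d) g"
proof -
  note [simp] = Y
  have [simp]: "M \<in> Obj C" "\<phi> \<in> Arr C" "Dom C \<phi> = h \<boxtimes> M" "Cod C \<phi> = M"
    "D \<in> Obj C" "e \<in> Arr C" "Dom C e = D" "Cod C e = \<K>" "d \<in> Arr C" "Dom C d = D" "Cod C d = D \<boxtimes> D"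
    "f \<in> Arr C" "Dom C f = D" "Cod C f = h" "f' \<in> Arr C" "Dom C f' = D" "Cod C f' = h"
    "g \<in> Arr C" "Dom C g = D \<boxtimes> Y" "Cod C g = M"
    using M D f f' g by (auto simp: left_module_def in_hom_iff)
  have ass: "\<phi> \<cdot> (\<one> h \<otimes> \<phi>) = \<phi> \<cdot> (\<mu>\<^bsub>H\<^esub> \<otimes> \<one> M)"
    and co: "(\<one> D \<otimes> d) \<cdot> d = (d \<otimes> \<one> D) \<cdot> d"
    using M D by (auto simp: left_module_def)
  have "convolve \<phi> d Y f (convolve \<phi> d Y f' g)
    = (\<phi> \<cdot> (\<one> h \<otimes> \<phi>)) \<cdot> (f \<otimes> f' \<otimes> g) \<cdot> (((\<one> D \<otimes> d) \<cdot> d) \<otimes> \<one> Y)"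
    unfolding convolve_def by (simp add: slice)
  also have "\<dots> = convolve \<phi> d Y (\<mu>\<^bsub>H\<^esub> \<cdot> (f \<otimes> f') \<cdot> d) g"
    unfolding ass co convolve_def by (simp add: slice)
  finally show ?thesis .
qed

lemma left_module_types:
  assumes "left_module H M \<phi>"
  shows "M \<in> Obj C" "\<phi> \<in> Arr C" "Dom C \<phi> = h \<boxtimes> M" "Cod C \<phi> = M"
  using assms by (auto simp: left_module_def in_hom_iff)

lemma convolve_unit:
  assumes M: "left_module H M \<phi>" and D: "is_coalgebra (D, e, d)"
    and g: "g \<in> hom C (D \<boxtimes> Y) M" and Y: "Y \<in> Obj C"
  shows "convolve \<phi> d Y (\<eta>\<^bsub>H\<^esub> \<cdot> e) g = g"
proof -
  note [simp] = Y left_module_types[OF M]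
  have [simp]: "D \<in> Obj C" "e \<in> Arr C" "Dom C e = D" "Cod C e = \<K>" "d \<in> Arr C" "Dom C d = D" "Cod C d = D \<boxtimes> D"
    "g \<in> Arr C" "Dom C g = D \<boxtimes> Y" "Cod C g = M"
    using D g by (auto simp: in_hom_iff)
  have un: "\<phi> \<cdot> (\<eta>\<^bsub>H\<^esub> \<otimes> \<one> M) = \<one> M" and co: "(e \<otimes> \<one> D) \<cdot> d = \<one> D"
    using M D by (auto simp: left_module_def)
  have "convolve \<phi> d Y (\<eta>\<^bsub>H\<^esub> \<cdot> e) g = (\<phi> \<cdot> (\<eta>\<^bsub>H\<^esub> \<otimes> \<one> M)) \<cdot> g \<cdot> (((e \<otimes> \<one> D) \<cdot> d) \<otimes> \<one> Y)"
    unfolding convolve_def by (simp add: slice exchange_counit)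
  also have "\<dots> = g"
    unfolding un co by simp
  finally show ?thesis .
qed

text \<open>A coalgebra morphism \<open>f\<close> is invertible in the convolution monoid with
  inverse \<open>antipode H \<cdot> f\<close>: it carries \<open>d\<close> to the comultiplication
  of \<open>H\<close>, so the antipode laws can be pulled back along it.\<close>

lemma convolve_inverse:
  assumes M: "left_module H M \<phi>" and D: "is_coalgebra (D, e, d)"
    and f: "coalg_morphism (D, e, d) (coalg_of H) f"
    and g: "g \<in> hom C (D \<boxtimes> Y) M" and Y: "Y \<in> Obj C"
  shows "convolve \<phi> d Y (antipode H \<cdot> f) (convolve \<phi> d Y f g) = g"
    "convolve \<phi> d Y f (convolve \<phi> d Y (antipode H \<cdot> f) g) = g"
proof -
  have [simp]: "D \<in> Obj C" "e \<in> Arr C" "Dom C e = D" "Cod C e = \<K>" "d \<in> Arr C" "Dom C d = D" "Cod C d = D \<boxtimes> D"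
    "f \<in> Arr C" "Dom C f = D" "Cod C f = h"
    using D f by (auto simp: in_hom_iff coalg_of_def)
  have ef: "\<epsilon>\<^bsub>H\<^esub> \<cdot> f = e" and df: "(f \<otimes> f) \<cdot> d = \<delta>\<^bsub>H\<^esub> \<cdot> f"
    using f by (auto simp: coalg_of_def)
  have "\<mu>\<^bsub>H\<^esub> \<cdot> ((antipode H \<cdot> f) \<otimes> f) \<cdot> d = \<mu>\<^bsub>H\<^esub> \<cdot> (antipode H \<otimes> \<one> h) \<cdot> (f \<otimes> f) \<cdot> d"
    by (simp add: slice)
  also have "\<dots> = (\<mu>\<^bsub>H\<^esub> \<cdot> (antipode H \<otimes> \<one> h) \<cdot> \<delta>\<^bsub>H\<^esub>) \<cdot> f"
    unfolding df by simp
  also have "\<dots> = \<eta>\<^bsub>H\<^esub> \<cdot> e"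
    unfolding antipode_laws ef[symmetric] by simp
  finally have 1: "\<mu>\<^bsub>H\<^esub> \<cdot> ((antipode H \<cdot> f) \<otimes> f) \<cdot> d = \<eta>\<^bsub>H\<^esub> \<cdot> e" .
  have "\<mu>\<^bsub>H\<^esub> \<cdot> (f \<otimes> (antipode H \<cdot> f)) \<cdot> d = \<mu>\<^bsub>H\<^esub> \<cdot> (\<one> h \<otimes> antipode H) \<cdot> (f \<otimes> f) \<cdot> d"
    by (simp add: slice)
  also have "\<dots> = (\<mu>\<^bsub>H\<^esub> \<cdot> (\<one> h \<otimes> antipode H) \<cdot> \<delta>\<^bsub>H\<^esub>) \<cdot> f"
    unfolding df by simp
  also have "\<dots> = \<eta>\<^bsub>H\<^esub> \<cdot> e"
    unfolding antipode_laws ef[symmetric] by simp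
  finally have 2: "\<mu>\<^bsub>H\<^esub> \<cdot> (f \<otimes> (antipode H \<cdot> f)) \<cdot> d = \<eta>\<^bsub>H\<^esub> \<cdot> e" .
  show "convolve \<phi> d Y (antipode H \<cdot> f) (convolve \<phi> d Y f g) = g"
    by (subst left_module_convolve_assoc[OF M D])
       (use g Y in \<open>auto simp: 1 in_hom_iff convolve_unit[OF M D]\<close>)
  show "convolve \<phi> d Y f (convolve \<phi> d Y (antipode H \<cdot> f) g) = g"
    by (subst left_module_convolve_assoc[OF M D])
       (use g Y in \<open>auto simp: 2 in_hom_iff convolve_unit[OF M D]\<close>)
qed

lemma Gam_convolve: "Gam H M \<phi> \<psi> = convolve \<phi> \<delta>\<^bsub>H\<^esub> M (antipode H) \<psi>"
  by (simp add: Gam_def convolve_def)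

lemma coalg_morphism_ident: "coalg_morphism (h, \<epsilon>\<^bsub>H\<^esub>, \<delta>\<^bsub>H\<^esub>) (coalg_of H) (\<one> h)"
  by (auto simp: coalg_of_def in_hom_iff)

lemma convolve_antipode:
  assumes M: "left_module H M \<phi>" and g: "g \<in> hom C (h \<boxtimes> Y) M" and Y: "Y \<in> Obj C"
  shows "convolve \<phi> \<delta>\<^bsub>H\<^esub> Y (antipode H) (convolve \<phi> \<delta>\<^bsub>H\<^esub> Y (\<one> h) g) = g"
    "convolve \<phi> \<delta>\<^bsub>H\<^esub> Y (\<one> h) (convolve \<phi> \<delta>\<^bsub>H\<^esub> Y (antipode H) g) = g"
  using convolve_inverse[OF M coalg coalg_morphism_ident g Y] by auto

end

section \<open>A second Hopf structure whose product is a convolution\<close>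

text \<open>Isolates what the comparison of modules uses. \<open>B\<close> and \<open>T\<close> do
  not occur: their effect is contained in \<open>\<sigma>\<close>, and \<open>\<psi>\<close> below
  stands for a \<open>B\<close>-action already pulled back along \<open>T\<close>.\<close>

locale twisted_hopf = hopf_algebra C H for C :: "('o, 'm) braided_data" (structure) and H +
  fixes H2 :: "('o, 'm) hopf" and \<sigma> :: 'm
  assumes hopf2: "is_hopf H2"
    and coalg2: "coalg_of H2 = coalg_of H"
    and unit2: "\<eta>\<^bsub>H2\<^esub> = \<eta>\<^bsub>H\<^esub>"
    and \<sigma>: "\<sigma> \<in> hom C (h \<boxtimes> h) h"
    and mult2: "\<mu>\<^bsub>H2\<^esub> = convolve \<mu>\<^bsub>H\<^esub> \<delta>\<^bsub>H\<^esub> h (\<one> h) \<sigma>"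
begin

lemma carr2 [simp]: "carr H2 = h" "\<epsilon>\<^bsub>H2\<^esub> = \<epsilon>\<^bsub>H\<^esub>" "\<delta>\<^bsub>H2\<^esub> = \<delta>\<^bsub>H\<^esub>"
  using coalg2 by (auto simp: coalg_of_def)

sublocale H2: hopf_algebra C H2
  rewrites "carr H2 = h" and "\<epsilon>\<^bsub>H2\<^esub> = \<epsilon>\<^bsub>H\<^esub>" and "\<delta>\<^bsub>H2\<^esub> = \<delta>\<^bsub>H\<^esub>" and "\<eta>\<^bsub>H2\<^esub> = \<eta>\<^bsub>H\<^esub>"
  using unit2 by (unfold_locales, auto simp: hopf2)

lemma \<sigma>_types [simp]: "\<sigma> \<in> Arr C" "Dom C \<sigma> = h \<boxtimes> h" "Cod C \<sigma> = h"
  using \<sigma> by (auto simp: in_hom_iff)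

text \<open>The link between the two actions on \<open>M\<close> in a module over the Rota-Baxter
  operator, pulled back along \<open>T\<close>. For \<open>M = h\<close>, with the product of
  \<open>H\<close> as \<open>\<phi>\<close> and \<open>\<sigma>\<close> as \<open>\<psi>\<close>, it
  says that the action on \<open>H\<close> respects the product of \<open>H\<close>.\<close>

abbreviation compat :: "'o \<Rightarrow> 'm \<Rightarrow> 'm \<Rightarrow> bool" where
  "compat M \<phi> \<psi> \<equiv> \<psi> \<cdot> (\<one> h \<otimes> \<phi>) =
     \<phi> \<cdot> (\<sigma> \<otimes> \<psi>) \<cdot> (\<one> h \<otimes> \<c> h h \<otimes> \<one> M) \<cdot> (\<delta>\<^bsub>H\<^esub> \<otimes> \<one> h \<otimes> \<one> M)"

text \<open>In elements, \<open>\<phi>(h1, \<phi>(\<sigma>(h2, x), \<psi>(h3, m)))\<close> contracts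
  by associativity of \<open>\<phi>\<close>, and the product of \<open>h1\<close> with
  \<open>\<sigma>(h2, x)\<close> in \<open>H\<close> is the product of \<open>h1\<close> and
  \<open>x\<close> from \<open>H2\<close>, up to reindexing by coassociativity.\<close>

lemma convolve_distrib:
  assumes M: "left_module H M \<phi>" and p: "\<psi> \<in> hom C (h \<boxtimes> M) M"
  shows "convolve \<phi> \<delta>\<^bsub>H\<^esub> (h \<boxtimes> M) (\<one> h) (\<phi> \<cdot> (\<sigma> \<otimes> \<psi>) \<cdot> (\<one> h \<otimes> \<c> h h \<otimes> \<one> M) \<cdot> (\<delta>\<^bsub>H\<^esub> \<otimes> \<one> h \<otimes> \<one> M))
    = \<phi> \<cdot> (\<mu>\<^bsub>H2\<^esub> \<otimes> \<psi>) \<cdot> (\<one> h \<otimes> \<c> h h \<otimes> \<one> M) \<cdot> (\<delta>\<^bsub>H\<^esub> \<otimes> \<one> h \<otimes> \<one> M)" (is "?l = ?r")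
proof -
  note [simp] = left_module_types[OF M]
  have [simp]: "\<psi> \<in> Arr C" "Dom C \<psi> = h \<boxtimes> M" "Cod C \<psi> = M"
    using p by (auto simp: in_hom_iff)
  have ass: "\<phi> \<cdot> (\<one> h \<otimes> \<phi>) = \<phi> \<cdot> (\<mu>\<^bsub>H\<^esub> \<otimes> \<one> M)"
    using M by (auto simp: left_module_def)
  have "?l = (\<phi> \<cdot> (\<one> h \<otimes> \<phi>)) \<cdot> (\<one> h \<otimes> \<sigma> \<otimes> \<psi>) \<cdot> (\<one> h \<otimes> \<one> h \<otimes> \<c> h h \<otimes> \<one> M)
      \<cdot> (((\<one> h \<otimes> \<delta>\<^bsub>H\<^esub>) \<cdot> \<delta>\<^bsub>H\<^esub>) \<otimes> \<one> h \<otimes> \<one> M)"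
    unfolding convolve_def by (simp add: slice)
  also have "\<dots> = ?r"
    unfolding ass coalg_laws mult2 convolve_def by (simp add: slice)
  finally show ?thesis .
qed

text \<open>The right-hand equation is the compatibility of a brace module for the convolved action,
  once \<open>\<psi>\<close> is recognised as its \<open>\<Gamma>\<close>.\<close>

lemma compat_iff:
  assumes M: "left_module H M \<phi>" and p: "\<psi> \<in> hom C (h \<boxtimes> M) M"
  shows "compat M \<phi> \<psi> \<longleftrightarrow> convolve \<phi> \<delta>\<^bsub>H\<^esub> M (\<one> h) \<psi> \<cdot> (\<one> h \<otimes> \<phi>) =
    \<phi> \<cdot> (\<mu>\<^bsub>H2\<^esub> \<otimes> \<psi>) \<cdot> (\<one> h \<otimes> \<c> h h \<otimes> \<one> M) \<cdot> (\<delta>\<^bsub>H\<^esub> \<otimes> \<one> h \<otimes> \<one> M)"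
proof -
  note [simp] = left_module_types[OF M]
  have [simp]: "\<psi> \<in> Arr C" "Dom C \<psi> = h \<boxtimes> M" "Cod C \<psi> = M"
    using p by (auto simp: in_hom_iff)
  have "convolve \<phi> \<delta>\<^bsub>H\<^esub> M (\<one> h) \<psi> \<cdot> (\<one> h \<otimes> \<phi>)
      = convolve \<phi> \<delta>\<^bsub>H\<^esub> (h \<boxtimes> M) (\<one> h) (\<psi> \<cdot> (\<one> h \<otimes> \<phi>))"
    unfolding convolve_def by (simp add: slice)
  moreover have "\<psi> \<cdot> (\<one> h \<otimes> \<phi>) \<in> hom C (h \<boxtimes> h \<boxtimes> M) M"
    "\<phi> \<cdot> (\<sigma> \<otimes> \<psi>) \<cdot> (\<one> h \<otimes> \<c> h h \<otimes> \<one> M) \<cdot> (\<delta>\<^bsub>H\<^esub> \<otimes> \<one> h \<otimes> \<one> M) \<in> hom C (h \<boxtimes> h \<boxtimes> M) M"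
    by (simp_all add: in_hom_iff)
  moreover have "h \<boxtimes> M \<in> Obj C"
    by simp
  ultimately show ?thesis
    by (metis convolve_distrib[OF assms] convolve_antipode(1)[OF M])
qed

text \<open>Convolution with the coalgebra morphism \<open>\<mu>\<^bsub>H2\<^esub>\<close> is injective and turns the two sides of the
  associativity law for \<open>\<psi>\<close> into those for its twisted action.\<close>

lemma left_module_iff:
  assumes M: "left_module H M \<phi>" and p: "\<psi> \<in> hom C (h \<boxtimes> M) M" and c: "compat M \<phi> \<psi>"
  shows "left_module H2 M \<psi> \<longleftrightarrow> left_module H2 M (convolve \<phi> \<delta>\<^bsub>H\<^esub> M (\<one> h) \<psi>)"
proof -
  define D where "D = h \<boxtimes> h"
  define d where "d = (\<one> h \<otimes> \<c> h h \<otimes> \<one> h) \<cdot> (\<delta>\<^bsub>H\<^esub> \<otimes> \<delta>\<^bsub>H\<^esub>)"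
  define \<theta> where "\<theta> = convolve \<phi> \<delta>\<^bsub>H\<^esub> M (\<one> h) \<psi>"
  have coalg_D: "is_coalgebra (D, \<epsilon>\<^bsub>H\<^esub> \<otimes> \<epsilon>\<^bsub>H\<^esub>, d)"
    using is_coalgebra_tensor[OF coalg coalg] by (simp add: D_def d_def)
  have mult_morphism: "coalg_morphism (D, \<epsilon>\<^bsub>H\<^esub> \<otimes> \<epsilon>\<^bsub>H\<^esub>, d) (coalg_of H) \<mu>\<^bsub>H2\<^esub>"
    using hopf2 by (simp add: is_hopf_def coalg_of_def D_def d_def)
  note [simp] = left_module_types[OF M]
  have [simp]: "\<psi> \<in> Arr C" "Dom C \<psi> = h \<boxtimes> M" "Cod C \<psi> = M"
    using p by (auto simp: in_hom_iff)
  have un: "\<phi> \<cdot> (\<eta>\<^bsub>H\<^esub> \<otimes> \<one> M) = \<one> M"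
    using M by (auto simp: left_module_def)
  have \<theta> [simp]: "\<theta> \<in> Arr C" "Dom C \<theta> = h \<boxtimes> M" "Cod C \<theta> = M"
    by (simp_all add: \<theta>_def convolve_def)
  \<comment> \<open>The unit is grouplike and acts trivially through \<open>\<phi>\<close>, so
    convolving does not change what it does: the unit laws for \<open>\<psi>\<close> and
    \<open>\<theta>\<close> are the same equation.\<close>
  have "\<theta> \<cdot> (\<eta>\<^bsub>H\<^esub> \<otimes> \<one> M) = \<phi> \<cdot> (\<one> h \<otimes> \<psi>) \<cdot> ((\<delta>\<^bsub>H\<^esub> \<cdot> \<eta>\<^bsub>H\<^esub>) \<otimes> \<one> M)"
    unfolding \<theta>_def convolve_def by (simp add: slice)
  also have "\<dots> = (\<phi> \<cdot> (\<eta>\<^bsub>H\<^esub> \<otimes> \<one> M)) \<cdot> \<psi> \<cdot> (\<eta>\<^bsub>H\<^esub> \<otimes> \<one> M)"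
    unfolding unit_coalg_laws by (simp add: slice)
  also have "\<dots> = \<psi> \<cdot> (\<eta>\<^bsub>H\<^esub> \<otimes> \<one> M)"
    unfolding un by simp
  finally have unit: "\<theta> \<cdot> (\<eta>\<^bsub>H\<^esub> \<otimes> \<one> M) = \<psi> \<cdot> (\<eta>\<^bsub>H\<^esub> \<otimes> \<one> M)" .
  have c': "\<theta> \<cdot> (\<one> h \<otimes> \<phi>) = \<phi> \<cdot> (\<mu>\<^bsub>H2\<^esub> \<otimes> \<psi>) \<cdot> (\<one> h \<otimes> \<c> h h \<otimes> \<one> M) \<cdot> (\<delta>\<^bsub>H\<^esub> \<otimes> \<one> h \<otimes> \<one> M)"
    using c compat_iff[OF M p] by (simp add: \<theta>_def)
  have "convolve \<phi> d M \<mu>\<^bsub>H2\<^esub> (\<psi> \<cdot> (\<one> h \<otimes> \<psi>))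
    = (\<phi> \<cdot> (\<mu>\<^bsub>H2\<^esub> \<otimes> \<psi>) \<cdot> (\<one> h \<otimes> \<c> h h \<otimes> \<one> M) \<cdot> (\<delta>\<^bsub>H\<^esub> \<otimes> \<one> h \<otimes> \<one> M))
      \<cdot> (\<one> h \<otimes> \<one> h \<otimes> \<psi>) \<cdot> (\<one> h \<otimes> \<delta>\<^bsub>H\<^esub> \<otimes> \<one> M)"
    unfolding convolve_def d_def by (simp add: slice)
  \<comment> \<open>Compatibility enters here, in the convolved form \<open>c'\<close>: it pulls the
    inner \<open>\<phi>\<close> inside \<open>\<theta>\<close>, where it combines with the inner
    \<open>\<psi>\<close> to a second \<open>\<theta>\<close>.\<close>
  also have "\<dots> = \<theta> \<cdot> (\<one> h \<otimes> \<theta>)"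
    unfolding c'[symmetric] unfolding \<theta>_def convolve_def by (simp add: slice)
  finally have 1: "convolve \<phi> d M \<mu>\<^bsub>H2\<^esub> (\<psi> \<cdot> (\<one> h \<otimes> \<psi>)) = \<theta> \<cdot> (\<one> h \<otimes> \<theta>)" .
  have "convolve \<phi> d M \<mu>\<^bsub>H2\<^esub> (\<psi> \<cdot> (\<mu>\<^bsub>H2\<^esub> \<otimes> \<one> M))
    = \<phi> \<cdot> (\<one> h \<otimes> \<psi>) \<cdot> (((\<mu>\<^bsub>H2\<^esub> \<otimes> \<mu>\<^bsub>H2\<^esub>) \<cdot> (\<one> h \<otimes> \<c> h h \<otimes> \<one> h) \<cdot> (\<delta>\<^bsub>H\<^esub> \<otimes> \<delta>\<^bsub>H\<^esub>)) \<otimes> \<one> M)"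
    unfolding convolve_def d_def by (simp add: slice)
  also have "\<dots> = \<theta> \<cdot> (\<mu>\<^bsub>H2\<^esub> \<otimes> \<one> M)"
    unfolding H2.mult_coalg_laws[symmetric] \<theta>_def convolve_def by (simp add: slice)
  finally have 2: "convolve \<phi> d M \<mu>\<^bsub>H2\<^esub> (\<psi> \<cdot> (\<mu>\<^bsub>H2\<^esub> \<otimes> \<one> M)) = \<theta> \<cdot> (\<mu>\<^bsub>H2\<^esub> \<otimes> \<one> M)" .
  have "convolve \<phi> d M \<mu>\<^bsub>H2\<^esub> a = convolve \<phi> d M \<mu>\<^bsub>H2\<^esub> b \<longleftrightarrow> a = b"
    if "a \<in> hom C (D \<boxtimes> M) M" "b \<in> hom C (D \<boxtimes> M) M" for a b
    using that convolve_inverse(1)[OF M coalg_D mult_morphism, of _ M] by (metis left_module_types(1)[OF M])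
  then have "\<psi> \<cdot> (\<one> h \<otimes> \<psi>) = \<psi> \<cdot> (\<mu>\<^bsub>H2\<^esub> \<otimes> \<one> M) \<longleftrightarrow> \<theta> \<cdot> (\<one> h \<otimes> \<theta>) = \<theta> \<cdot> (\<mu>\<^bsub>H2\<^esub> \<otimes> \<one> M)"
    unfolding 1[symmetric] 2[symmetric] by (simp add: in_hom_iff D_def)
  then show ?thesis
    unfolding \<theta>_def[symmetric]
    by (simp add: left_module_def in_hom_iff unit unit2)
qed

text \<open>Convolving with the antipode undoes the twist, so \<open>Gam\<close> of the convolved
  action is \<open>\<psi>\<close>. The brace compatibility is then \<open>compat\<close> by
  \<open>compat_iff\<close>, and under \<open>compat\<close> the two module laws agree.\<close>

lemma brace_module_iff:
  assumes M: "left_module H M \<phi>" and p: "\<psi> \<in> hom C (h \<boxtimes> M) M"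
  shows "brace_module H H2 (M, \<phi>, convolve \<phi> \<delta>\<^bsub>H\<^esub> M (\<one> h) \<psi>) \<longleftrightarrow> left_module H2 M \<psi> \<and> compat M \<phi> \<psi>"
proof -
  have "Gam H M \<phi> (convolve \<phi> \<delta>\<^bsub>H\<^esub> M (\<one> h) \<psi>) = \<psi>"
    unfolding Gam_convolve using convolve_antipode(1)[OF M p] left_module_types[OF M] by simp
  then show ?thesis
    using M compat_iff[OF M p] left_module_iff[OF M p] left_module_types(1)[OF M]
    unfolding brace_module.simps by metis
qed

text \<open>The regular module \<open>h\<close>, with \<open>\<sigma>\<close> in the role of
  \<open>\<psi>\<close>: its convolved action is the product of \<open>H2\<close>.\<close>

lemma hopf_brace:
  assumes "compat h \<mu>\<^bsub>H\<^esub> \<sigma>"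
  shows "hopf_brace H H2"
proof -
  have M: "left_module H h \<mu>\<^bsub>H\<^esub>"
    using alg_laws by (simp add: left_module_def in_hom_iff)
  have "Gam H h \<mu>\<^bsub>H\<^esub> \<mu>\<^bsub>H2\<^esub> = \<sigma>"
    unfolding Gam_convolve mult2 using convolve_antipode(1)[OF M \<sigma>] by simp
  then show ?thesis
    using assms compat_iff[OF M \<sigma>] hopf hopf2 coalg2 unit2
    unfolding hopf_brace_def mult2[symmetric] by metis
qed

end

section \<open>Transport of Hopf structure and modules along a coalgebra isomorphism\<close>

text \<open>The algebra and antipode laws of \<open>H2\<close> are not assumed. Its operations are
  given by explicit formulas in the application, so it is enough that they are well typed and that
  \<open>T\<close> carries them to those of \<open>B\<close>.\<close>

locale hopf_iso = strict_braided_monoidal_category C + B: hopf_algebra C B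
  for C :: "('o, 'm) braided_data" (structure) and B +
  fixes H2 :: "('o, 'm) hopf" and T S :: 'm
  assumes coalg: "is_coalgebra (coalg_of H2)"
    and T: "coalg_morphism (coalg_of H2) (coalg_of B) T"
    and S: "inverse_arrows C T S"
    and unit_hom: "\<eta>\<^bsub>H2\<^esub> \<in> hom C \<K> (carr H2)"
    and mult_hom: "\<mu>\<^bsub>H2\<^esub> \<in> hom C (carr H2 \<boxtimes> carr H2) (carr H2)"
    and antipode_hom: "antipode H2 \<in> hom C (carr H2) (carr H2)"
    and T_unit: "T \<cdot> \<eta>\<^bsub>H2\<^esub> = \<eta>\<^bsub>B\<^esub>"
    and T_mult: "T \<cdot> \<mu>\<^bsub>H2\<^esub> = \<mu>\<^bsub>B\<^esub> \<cdot> (T \<otimes> T)"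
    and T_antipode: "T \<cdot> antipode H2 = antipode B \<cdot> T"
begin

abbreviation "h \<equiv> carr H2"
abbreviation "b \<equiv> carr B"

lemma iso_types [simp]:
  "h \<in> Obj C"
  "\<eta>\<^bsub>H2\<^esub> \<in> Arr C" "Dom C \<eta>\<^bsub>H2\<^esub> = \<K>" "Cod C \<eta>\<^bsub>H2\<^esub> = h"
  "\<mu>\<^bsub>H2\<^esub> \<in> Arr C" "Dom C \<mu>\<^bsub>H2\<^esub> = h \<boxtimes> h" "Cod C \<mu>\<^bsub>H2\<^esub> = h"
  "\<epsilon>\<^bsub>H2\<^esub> \<in> Arr C" "Dom C \<epsilon>\<^bsub>H2\<^esub> = h" "Cod C \<epsilon>\<^bsub>H2\<^esub> = \<K>"
  "\<delta>\<^bsub>H2\<^esub> \<in> Arr C" "Dom C \<delta>\<^bsub>H2\<^esub> = h" "Cod C \<delta>\<^bsub>H2\<^esub> = h \<boxtimes> h"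
  "antipode H2 \<in> Arr C" "Dom C (antipode H2) = h" "Cod C (antipode H2) = h"
  "T \<in> Arr C" "Dom C T = h" "Cod C T = b"
  "S \<in> Arr C" "Dom C S = b" "Cod C S = h"
  using coalg T S unit_hom mult_hom antipode_hom
  by (auto simp: coalg_of_def in_hom_iff inverse_arrows_def)

lemma S_T: "S \<cdot> T = \<one> h" and T_S: "T \<cdot> S = \<one> b"
  using S by (auto simp: inverse_arrows_def)

lemma T_counit: "\<epsilon>\<^bsub>B\<^esub> \<cdot> T = \<epsilon>\<^bsub>H2\<^esub>" and T_comult: "\<delta>\<^bsub>B\<^esub> \<cdot> T = (T \<otimes> T) \<cdot> \<delta>\<^bsub>H2\<^esub>"
  using T by (auto simp: coalg_of_def)

lemma T_cancel:
  assumes "T \<cdot> x = T \<cdot> y" "x \<in> hom C X h" "y \<in> hom C X h"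
  shows "x = y"
proof -
  have "(S \<cdot> T) \<cdot> x = (S \<cdot> T) \<cdot> y"
    using assms by (auto simp: in_hom_iff)
  then show ?thesis
    using assms by (auto simp: S_T in_hom_iff)
qed

lemma TT_cancel:
  assumes "(T \<otimes> T) \<cdot> x = (T \<otimes> T) \<cdot> y" "x \<in> hom C X (h \<boxtimes> h)" "y \<in> hom C X (h \<boxtimes> h)"
  shows "x = y"
proof -
  have "((S \<otimes> S) \<cdot> (T \<otimes> T)) \<cdot> x = ((S \<otimes> S) \<cdot> (T \<otimes> T)) \<cdot> y"
    using assms by (auto simp: in_hom_iff)
  then show ?thesis
    using assms by (auto simp: S_T in_hom_iff interchange[symmetric])
qed

lemma T_tensor_cancel:
  assumes "x \<cdot> (T \<otimes> \<one> Y) = y \<cdot> (T \<otimes> \<one> Y)" "x \<in> hom C (b \<boxtimes> Y) X" "y \<in> hom C (b \<boxtimes> Y) X" "Y \<in> Obj C"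
  shows "x = y"
proof -
  have "(x \<cdot> (T \<otimes> \<one> Y)) \<cdot> (S \<otimes> \<one> Y) = (y \<cdot> (T \<otimes> \<one> Y)) \<cdot> (S \<otimes> \<one> Y)"
    using assms by simp
  then show ?thesis
    using assms(2-4) by (simp add: T_S in_hom_iff interchange[symmetric])
qed

text \<open>Identities with values in \<open>h\<close> or \<open>h \<boxtimes> h\<close> are tested
  after composing with \<open>T\<close> or \<open>T \<otimes> T\<close>, which can be cancelled;
  there they become the laws of \<open>B\<close>. The product and the comultiplication additionally
  need naturality of the braiding at \<open>T\<close>.\<close>

lemma is_hopf: "is_hopf H2"
proof -
  have "\<mu>\<^bsub>H2\<^esub> \<cdot> (\<one> h \<otimes> \<eta>\<^bsub>H2\<^esub>) = \<one> h"
  proof (rule T_cancel)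
    have "T \<cdot> \<mu>\<^bsub>H2\<^esub> \<cdot> (\<one> h \<otimes> \<eta>\<^bsub>H2\<^esub>) = (T \<cdot> \<mu>\<^bsub>H2\<^esub>) \<cdot> (\<one> h \<otimes> \<eta>\<^bsub>H2\<^esub>)"
      by simp
    also have "\<dots> = (\<mu>\<^bsub>B\<^esub> \<cdot> (\<one> b \<otimes> (T \<cdot> \<eta>\<^bsub>H2\<^esub>))) \<cdot> T"
      unfolding T_mult by (simp add: slice exchange_unit)
    finally show "T \<cdot> \<mu>\<^bsub>H2\<^esub> \<cdot> (\<one> h \<otimes> \<eta>\<^bsub>H2\<^esub>) = T \<cdot> \<one> h"
      unfolding T_unit B.alg_laws by simp
  qed (simp_all add: in_hom_iff)
  moreover have "\<mu>\<^bsub>H2\<^esub> \<cdot> (\<eta>\<^bsub>H2\<^esub> \<otimes> \<one> h) = \<one> h"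
  proof (rule T_cancel)
    have "T \<cdot> \<mu>\<^bsub>H2\<^esub> \<cdot> (\<eta>\<^bsub>H2\<^esub> \<otimes> \<one> h) = (T \<cdot> \<mu>\<^bsub>H2\<^esub>) \<cdot> (\<eta>\<^bsub>H2\<^esub> \<otimes> \<one> h)"
      by simp
    also have "\<dots> = (\<mu>\<^bsub>B\<^esub> \<cdot> ((T \<cdot> \<eta>\<^bsub>H2\<^esub>) \<otimes> \<one> b)) \<cdot> T"
      unfolding T_mult by (simp add: slice)
    finally show "T \<cdot> \<mu>\<^bsub>H2\<^esub> \<cdot> (\<eta>\<^bsub>H2\<^esub> \<otimes> \<one> h) = T \<cdot> \<one> h"
      unfolding T_unit B.alg_laws by simp
  qed (simp_all add: in_hom_iff)
  moreover have "\<mu>\<^bsub>H2\<^esub> \<cdot> (\<one> h \<otimes> \<mu>\<^bsub>H2\<^esub>) = \<mu>\<^bsub>H2\<^esub> \<cdot> (\<mu>\<^bsub>H2\<^esub> \<otimes> \<one> h)"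
  proof (rule T_cancel)
    have "T \<cdot> \<mu>\<^bsub>H2\<^esub> \<cdot> (\<one> h \<otimes> \<mu>\<^bsub>H2\<^esub>) = (T \<cdot> \<mu>\<^bsub>H2\<^esub>) \<cdot> (\<one> h \<otimes> \<mu>\<^bsub>H2\<^esub>)"
      by simp
    also have "\<dots> = (\<mu>\<^bsub>B\<^esub> \<cdot> (T \<otimes> T)) \<cdot> (\<one> h \<otimes> \<mu>\<^bsub>H2\<^esub>)"
      unfolding T_mult ..
    also have "\<dots> = \<mu>\<^bsub>B\<^esub> \<cdot> (T \<otimes> (T \<cdot> \<mu>\<^bsub>H2\<^esub>))"
      by (simp add: slice)
    also have "\<dots> = (\<mu>\<^bsub>B\<^esub> \<cdot> (\<one> b \<otimes> \<mu>\<^bsub>B\<^esub>)) \<cdot> (T \<otimes> T \<otimes> T)"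
      unfolding T_mult by (simp add: slice)
    also have "\<dots> = \<mu>\<^bsub>B\<^esub> \<cdot> ((T \<cdot> \<mu>\<^bsub>H2\<^esub>) \<otimes> T)"
      unfolding B.alg_laws T_mult by (simp add: slice)
    also have "\<dots> = (\<mu>\<^bsub>B\<^esub> \<cdot> (T \<otimes> T)) \<cdot> (\<mu>\<^bsub>H2\<^esub> \<otimes> \<one> h)"
      by (simp add: slice)
    also have "\<dots> = (T \<cdot> \<mu>\<^bsub>H2\<^esub>) \<cdot> (\<mu>\<^bsub>H2\<^esub> \<otimes> \<one> h)"
      unfolding T_mult ..
    finally show "T \<cdot> \<mu>\<^bsub>H2\<^esub> \<cdot> (\<one> h \<otimes> \<mu>\<^bsub>H2\<^esub>) = T \<cdot> \<mu>\<^bsub>H2\<^esub> \<cdot> (\<mu>\<^bsub>H2\<^esub> \<otimes> \<one> h)"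
      by simp
  qed (simp_all add: in_hom_iff)
  moreover have "\<epsilon>\<^bsub>H2\<^esub> \<cdot> \<eta>\<^bsub>H2\<^esub> = \<one> \<K>"
    using B.unit_coalg_laws(1) by (simp add: T_counit[symmetric] T_unit)
  moreover have "\<delta>\<^bsub>H2\<^esub> \<cdot> \<eta>\<^bsub>H2\<^esub> = \<eta>\<^bsub>H2\<^esub> \<otimes> \<eta>\<^bsub>H2\<^esub>"
  proof (rule TT_cancel)
    have "(T \<otimes> T) \<cdot> \<delta>\<^bsub>H2\<^esub> \<cdot> \<eta>\<^bsub>H2\<^esub> = ((T \<otimes> T) \<cdot> \<delta>\<^bsub>H2\<^esub>) \<cdot> \<eta>\<^bsub>H2\<^esub>"
      by simp
    also have "\<dots> = \<delta>\<^bsub>B\<^esub> \<cdot> (T \<cdot> \<eta>\<^bsub>H2\<^esub>)"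
      unfolding T_comult[symmetric] by simp
    also have "\<dots> = (T \<otimes> T) \<cdot> (\<eta>\<^bsub>H2\<^esub> \<otimes> \<eta>\<^bsub>H2\<^esub>)"
      by (simp add: interchange[symmetric] T_unit B.unit_coalg_laws)
    finally show "(T \<otimes> T) \<cdot> \<delta>\<^bsub>H2\<^esub> \<cdot> \<eta>\<^bsub>H2\<^esub> = (T \<otimes> T) \<cdot> (\<eta>\<^bsub>H2\<^esub> \<otimes> \<eta>\<^bsub>H2\<^esub>)" .
  qed (simp_all add: in_hom_iff)
  moreover have "\<epsilon>\<^bsub>H2\<^esub> \<cdot> \<mu>\<^bsub>H2\<^esub> = \<epsilon>\<^bsub>H2\<^esub> \<otimes> \<epsilon>\<^bsub>H2\<^esub>"
  proof -
    have "\<epsilon>\<^bsub>H2\<^esub> \<cdot> \<mu>\<^bsub>H2\<^esub> = \<epsilon>\<^bsub>B\<^esub> \<cdot> (T \<cdot> \<mu>\<^bsub>H2\<^esub>)"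
      by (simp add: T_counit[symmetric])
    also have "\<dots> = (\<epsilon>\<^bsub>B\<^esub> \<cdot> \<mu>\<^bsub>B\<^esub>) \<cdot> (T \<otimes> T)"
      unfolding T_mult by simp
    finally show ?thesis
      by (simp add: B.mult_coalg_laws interchange[symmetric] T_counit)
  qed
  moreover have "\<delta>\<^bsub>H2\<^esub> \<cdot> \<mu>\<^bsub>H2\<^esub> = (\<mu>\<^bsub>H2\<^esub> \<otimes> \<mu>\<^bsub>H2\<^esub>) \<cdot> (\<one> h \<otimes> \<c> h h \<otimes> \<one> h) \<cdot> (\<delta>\<^bsub>H2\<^esub> \<otimes> \<delta>\<^bsub>H2\<^esub>)"
  proof (rule TT_cancel)
    have "(T \<otimes> T) \<cdot> \<delta>\<^bsub>H2\<^esub> \<cdot> \<mu>\<^bsub>H2\<^esub> = ((T \<otimes> T) \<cdot> \<delta>\<^bsub>H2\<^esub>) \<cdot> \<mu>\<^bsub>H2\<^esub>"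
      by simp
    also have "\<dots> = \<delta>\<^bsub>B\<^esub> \<cdot> (T \<cdot> \<mu>\<^bsub>H2\<^esub>)"
      unfolding T_comult[symmetric] by simp
    also have "\<dots> = (\<delta>\<^bsub>B\<^esub> \<cdot> \<mu>\<^bsub>B\<^esub>) \<cdot> (T \<otimes> T)"
      unfolding T_mult by simp
    also have "\<dots> = (\<mu>\<^bsub>B\<^esub> \<otimes> \<mu>\<^bsub>B\<^esub>) \<cdot> (\<one> b \<otimes> \<c> b b \<otimes> \<one> b) \<cdot> ((\<delta>\<^bsub>B\<^esub> \<cdot> T) \<otimes> (\<delta>\<^bsub>B\<^esub> \<cdot> T))"
      unfolding B.mult_coalg_laws by (simp add: interchange)
    also have "\<dots> = (\<mu>\<^bsub>B\<^esub> \<otimes> \<mu>\<^bsub>B\<^esub>) \<cdot> (T \<otimes> (\<c> b b \<cdot> (T \<otimes> T)) \<otimes> T) \<cdot> (\<delta>\<^bsub>H2\<^esub> \<otimes> \<delta>\<^bsub>H2\<^esub>)"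
      unfolding T_comult by (simp add: slice)
    also have "\<c> b b \<cdot> (T \<otimes> T) = (T \<otimes> T) \<cdot> \<c> h h"
      using braid_natural[of T T] by simp
    also have "(\<mu>\<^bsub>B\<^esub> \<otimes> \<mu>\<^bsub>B\<^esub>) \<cdot> (T \<otimes> ((T \<otimes> T) \<cdot> \<c> h h) \<otimes> T) \<cdot> (\<delta>\<^bsub>H2\<^esub> \<otimes> \<delta>\<^bsub>H2\<^esub>)
      = ((\<mu>\<^bsub>B\<^esub> \<cdot> (T \<otimes> T)) \<otimes> (\<mu>\<^bsub>B\<^esub> \<cdot> (T \<otimes> T))) \<cdot> (\<one> h \<otimes> \<c> h h \<otimes> \<one> h) \<cdot> (\<delta>\<^bsub>H2\<^esub> \<otimes> \<delta>\<^bsub>H2\<^esub>)"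
      by (simp add: slice)
    also have "\<dots> = (T \<otimes> T) \<cdot> (\<mu>\<^bsub>H2\<^esub> \<otimes> \<mu>\<^bsub>H2\<^esub>) \<cdot> (\<one> h \<otimes> \<c> h h \<otimes> \<one> h) \<cdot> (\<delta>\<^bsub>H2\<^esub> \<otimes> \<delta>\<^bsub>H2\<^esub>)"
      unfolding T_mult[symmetric] by (simp add: interchange)
    finally show "(T \<otimes> T) \<cdot> \<delta>\<^bsub>H2\<^esub> \<cdot> \<mu>\<^bsub>H2\<^esub> = \<dots>" .
  qed (simp_all add: in_hom_iff)
  moreover have "\<mu>\<^bsub>H2\<^esub> \<cdot> (\<one> h \<otimes> antipode H2) \<cdot> \<delta>\<^bsub>H2\<^esub> = \<eta>\<^bsub>H2\<^esub> \<cdot> \<epsilon>\<^bsub>H2\<^esub>"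
  proof (rule T_cancel)
    have "T \<cdot> \<mu>\<^bsub>H2\<^esub> \<cdot> (\<one> h \<otimes> antipode H2) \<cdot> \<delta>\<^bsub>H2\<^esub> = (T \<cdot> \<mu>\<^bsub>H2\<^esub>) \<cdot> (\<one> h \<otimes> antipode H2) \<cdot> \<delta>\<^bsub>H2\<^esub>"
      by simp
    also have "\<dots> = \<mu>\<^bsub>B\<^esub> \<cdot> (T \<otimes> (T \<cdot> antipode H2)) \<cdot> \<delta>\<^bsub>H2\<^esub>"
      unfolding T_mult by (simp add: slice)
    also have "\<dots> = \<mu>\<^bsub>B\<^esub> \<cdot> (\<one> b \<otimes> antipode B) \<cdot> ((T \<otimes> T) \<cdot> \<delta>\<^bsub>H2\<^esub>)"
      unfolding T_antipode by (simp add: slice)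
    also have "\<dots> = (\<mu>\<^bsub>B\<^esub> \<cdot> (\<one> b \<otimes> antipode B) \<cdot> \<delta>\<^bsub>B\<^esub>) \<cdot> T"
      unfolding T_comult[symmetric] by simp
    also have "\<dots> = (T \<cdot> \<eta>\<^bsub>H2\<^esub>) \<cdot> \<epsilon>\<^bsub>H2\<^esub>"
      unfolding B.antipode_laws by (simp add: T_counit T_unit)
    finally show "T \<cdot> \<mu>\<^bsub>H2\<^esub> \<cdot> (\<one> h \<otimes> antipode H2) \<cdot> \<delta>\<^bsub>H2\<^esub> = T \<cdot> \<eta>\<^bsub>H2\<^esub> \<cdot> \<epsilon>\<^bsub>H2\<^esub>"
      by simp
  qed (simp_all add: in_hom_iff)
  moreover have "\<mu>\<^bsub>H2\<^esub> \<cdot> (antipode H2 \<otimes> \<one> h) \<cdot> \<delta>\<^bsub>H2\<^esub> = \<eta>\<^bsub>H2\<^esub> \<cdot> \<epsilon>\<^bsub>H2\<^esub>"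
  proof (rule T_cancel)
    have "T \<cdot> \<mu>\<^bsub>H2\<^esub> \<cdot> (antipode H2 \<otimes> \<one> h) \<cdot> \<delta>\<^bsub>H2\<^esub> = (T \<cdot> \<mu>\<^bsub>H2\<^esub>) \<cdot> (antipode H2 \<otimes> \<one> h) \<cdot> \<delta>\<^bsub>H2\<^esub>"
      by simp
    also have "\<dots> = \<mu>\<^bsub>B\<^esub> \<cdot> ((T \<cdot> antipode H2) \<otimes> T) \<cdot> \<delta>\<^bsub>H2\<^esub>"
      unfolding T_mult by (simp add: slice)
    also have "\<dots> = \<mu>\<^bsub>B\<^esub> \<cdot> (antipode B \<otimes> \<one> b) \<cdot> ((T \<otimes> T) \<cdot> \<delta>\<^bsub>H2\<^esub>)"
      unfolding T_antipode by (simp add: slice)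
    also have "\<dots> = (\<mu>\<^bsub>B\<^esub> \<cdot> (antipode B \<otimes> \<one> b) \<cdot> \<delta>\<^bsub>B\<^esub>) \<cdot> T"
      unfolding T_comult[symmetric] by simp
    also have "\<dots> = (T \<cdot> \<eta>\<^bsub>H2\<^esub>) \<cdot> \<epsilon>\<^bsub>H2\<^esub>"
      unfolding B.antipode_laws by (simp add: T_counit T_unit)
    finally show "T \<cdot> \<mu>\<^bsub>H2\<^esub> \<cdot> (antipode H2 \<otimes> \<one> h) \<cdot> \<delta>\<^bsub>H2\<^esub> = T \<cdot> \<eta>\<^bsub>H2\<^esub> \<cdot> \<epsilon>\<^bsub>H2\<^esub>"
      by simp
  qed (simp_all add: in_hom_iff)
  ultimately show ?thesis
    using coalg
    by (simp add: is_hopf_def is_alg_coalg_def is_algebra_def unit_coalg_def coalg_of_def in_hom_iff)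
qed

lemma left_module_iff:
  assumes p: "\<psi> \<in> hom C (b \<boxtimes> N) N" and N: "N \<in> Obj C"
  shows "left_module B N \<psi> \<longleftrightarrow> left_module H2 N (\<psi> \<cdot> (T \<otimes> \<one> N))"
proof -
  have [simp]: "\<psi> \<in> Arr C" "Dom C \<psi> = b \<boxtimes> N" "Cod C \<psi> = N" "N \<in> Obj C"
    using p N by (auto simp: in_hom_iff)
  have unit: "(\<psi> \<cdot> (T \<otimes> \<one> N)) \<cdot> (\<eta>\<^bsub>H2\<^esub> \<otimes> \<one> N) = \<psi> \<cdot> (\<eta>\<^bsub>B\<^esub> \<otimes> \<one> N)"
    unfolding T_unit[symmetric] by (simp add: slice)
  let ?a = "\<psi> \<cdot> (\<one> b \<otimes> \<psi>)" and ?b = "\<psi> \<cdot> (\<mu>\<^bsub>B\<^esub> \<otimes> \<one> N)" and ?T = "(T \<otimes> T) \<otimes> \<one> N" and ?S = "(S \<otimes> S) \<otimes> \<one> N"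
  have 1: "(\<psi> \<cdot> (T \<otimes> \<one> N)) \<cdot> (\<one> h \<otimes> (\<psi> \<cdot> (T \<otimes> \<one> N))) = ?a \<cdot> ?T"
    by (simp add: slice)
  have "(\<psi> \<cdot> (T \<otimes> \<one> N)) \<cdot> (\<mu>\<^bsub>H2\<^esub> \<otimes> \<one> N) = \<psi> \<cdot> ((T \<cdot> \<mu>\<^bsub>H2\<^esub>) \<otimes> \<one> N)"
    by (simp add: slice)
  then have 2: "(\<psi> \<cdot> (T \<otimes> \<one> N)) \<cdot> (\<mu>\<^bsub>H2\<^esub> \<otimes> \<one> N) = ?b \<cdot> ?T"
    unfolding T_mult by (simp add: slice)
  have "?T \<cdot> ?S = \<one> (b \<boxtimes> b \<boxtimes> N)"
    by (simp add: interchange[symmetric] T_S)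
  then have cancel: "(x \<cdot> ?T) \<cdot> ?S = x" if "x \<in> hom C (b \<boxtimes> b \<boxtimes> N) N" for x
    using that by (auto simp: in_hom_iff)
  have "?a \<in> hom C (b \<boxtimes> b \<boxtimes> N) N" "?b \<in> hom C (b \<boxtimes> b \<boxtimes> N) N"
    by (simp_all add: in_hom_iff)
  then have "?a \<cdot> ?T = ?b \<cdot> ?T \<longleftrightarrow> ?a = ?b"
    by (metis cancel)
  then show ?thesis
    unfolding left_module_def 1 2 unit by (auto simp: in_hom_iff)
qed

lemma left_module_morphism_iff:
  assumes p: "\<psi> \<in> hom C (b \<boxtimes> N) N" and N: "N \<in> Obj C"
    and p': "\<psi>' \<in> hom C (b \<boxtimes> Q) Q" and Q: "Q \<in> Obj C"
  shows "left_module_morphism B N \<psi> Q \<psi>' f \<longleftrightarrow>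
    left_module_morphism H2 N (\<psi> \<cdot> (T \<otimes> \<one> N)) Q (\<psi>' \<cdot> (T \<otimes> \<one> Q)) f"
proof (cases "f \<in> hom C N Q")
  case True
  then have [simp]: "\<psi> \<in> Arr C" "Dom C \<psi> = b \<boxtimes> N" "Cod C \<psi> = N" "N \<in> Obj C"
     "\<psi>' \<in> Arr C" "Dom C \<psi>' = b \<boxtimes> Q" "Cod C \<psi>' = Q" "Q \<in> Obj C" "f \<in> Arr C" "Dom C f = N" "Cod C f = Q"
    using p N p' Q by (auto simp: in_hom_iff)
  have "f \<cdot> \<psi> \<in> hom C (b \<boxtimes> N) Q" "\<psi>' \<cdot> (\<one> b \<otimes> f) \<in> hom C (b \<boxtimes> N) Q"
    by (simp_all add: in_hom_iff)
  then have "(f \<cdot> \<psi>) \<cdot> (T \<otimes> \<one> N) = (\<psi>' \<cdot> (\<one> b \<otimes> f)) \<cdot> (T \<otimes> \<one> N) \<longleftrightarrow> f \<cdot> \<psi> = \<psi>' \<cdot> (\<one> b \<otimes> f)"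
    using T_tensor_cancel N by metis
  moreover have "(\<psi>' \<cdot> (\<one> b \<otimes> f)) \<cdot> (T \<otimes> \<one> N) = (\<psi>' \<cdot> (T \<otimes> \<one> Q)) \<cdot> (\<one> h \<otimes> f)"
    by (simp add: slice)
  moreover have "(f \<cdot> \<psi>) \<cdot> (T \<otimes> \<one> N) = f \<cdot> \<psi> \<cdot> (T \<otimes> \<one> N)"
    by simp
  ultimately show ?thesis
    unfolding left_module_morphism_def by metis
qed (simp add: left_module_morphism_def)

end

section \<open>Invertible relative Rota-Baxter operators\<close>

locale rota_baxter_iso = strict_braided_monoidal_category C
  for C :: "('o, 'm) braided_data" (structure) +
  fixes H B :: "('o, 'm) hopf" and T \<phi>H :: 'm
  assumes rota_baxter: "rel_rota_baxter H B T \<phi>H"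
    and iso: "isomorphism C T"
begin

abbreviation "S \<equiv> inverse_of C T"
abbreviation "h \<equiv> carr H"
abbreviation "b \<equiv> carr B"
abbreviation "\<sigma> \<equiv> \<phi>H \<cdot> (T \<otimes> \<one> h)"
abbreviation "H2 \<equiv> assoc_hopf H B T \<phi>H"

lemma rb_laws:
  shows "is_hopf H" "is_hopf B" "left_module B h \<phi>H"
    "\<phi>H \<cdot> (\<one> b \<otimes> \<eta>\<^bsub>H\<^esub>) = \<epsilon>\<^bsub>B\<^esub> \<otimes> \<eta>\<^bsub>H\<^esub>"
    "\<phi>H \<cdot> (\<one> b \<otimes> \<mu>\<^bsub>H\<^esub>) = \<mu>\<^bsub>H\<^esub> \<cdot> (\<phi>H \<otimes> \<phi>H) \<cdot> (\<one> b \<otimes> \<c> b h \<otimes> \<one> h) \<cdot> (\<delta>\<^bsub>B\<^esub> \<otimes> \<one> h \<otimes> \<one> h)"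
    and T_coalg: "coalg_morphism (coalg_of H) (coalg_of B) T"
    and T_mult2: "\<mu>\<^bsub>B\<^esub> \<cdot> (T \<otimes> T) = T \<cdot> twisted_action H T h \<mu>\<^bsub>H\<^esub> \<phi>H"
  using rota_baxter unfolding rel_rota_baxter_def module_alg_coalg_def by blast+

lemma S: "inverse_arrows C T S"
  using iso by (rule inverse_arrows_inverse_of)

sublocale H: hopf_algebra C H
  by unfold_locales (rule rb_laws)

sublocale B: hopf_algebra C B
  by unfold_locales (rule rb_laws)

lemma rb_types [simp]:
  "\<phi>H \<in> Arr C" "Dom C \<phi>H = b \<boxtimes> h" "Cod C \<phi>H = h"
  "T \<in> Arr C" "Dom C T = h" "Cod C T = b"
  "S \<in> Arr C" "Dom C S = b" "Cod C S = h"
  using rb_laws(3) T_coalg S by (auto simp: left_module_def coalg_of_def in_hom_iff inverse_arrows_def)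

lemma T_counit: "\<epsilon>\<^bsub>B\<^esub> \<cdot> T = \<epsilon>\<^bsub>H\<^esub>" and T_comult: "\<delta>\<^bsub>B\<^esub> \<cdot> T = (T \<otimes> T) \<cdot> \<delta>\<^bsub>H\<^esub>"
  using T_coalg by (auto simp: coalg_of_def)

lemma assoc_hopf_simps [simp]:
  "carr H2 = h" "\<eta>\<^bsub>H2\<^esub> = \<eta>\<^bsub>H\<^esub>" "\<epsilon>\<^bsub>H2\<^esub> = \<epsilon>\<^bsub>H\<^esub>" "\<delta>\<^bsub>H2\<^esub> = \<delta>\<^bsub>H\<^esub>"
  by (simp_all add: assoc_hopf_def)

lemma twisted_action_convolve: "twisted_action H T M \<phi> \<psi> = convolve \<phi> \<delta>\<^bsub>H\<^esub> M (\<one> h) (\<psi> \<cdot> (T \<otimes> \<one> M))"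
  by (simp add: twisted_action_def convolve_def)

lemma mult2: "\<mu>\<^bsub>H2\<^esub> = convolve \<mu>\<^bsub>H\<^esub> \<delta>\<^bsub>H\<^esub> h (\<one> h) \<sigma>"
  by (simp add: assoc_hopf_def twisted_action_convolve)

lemma antipode2: "antipode H2 = \<phi>H \<cdot> ((antipode B \<cdot> T) \<otimes> antipode H) \<cdot> \<delta>\<^bsub>H\<^esub>"
  by (simp add: assoc_hopf_def)

lemma mult2_types [simp]: "\<mu>\<^bsub>H2\<^esub> \<in> Arr C" "Dom C \<mu>\<^bsub>H2\<^esub> = h \<boxtimes> h" "Cod C \<mu>\<^bsub>H2\<^esub> = h"
  by (simp_all add: mult2 convolve_def)

lemma antipode2_types [simp]: "antipode H2 \<in> Arr C" "Dom C (antipode H2) = h" "Cod C (antipode H2) = h"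
  by (simp_all add: antipode2)

lemma T_mult: "T \<cdot> \<mu>\<^bsub>H2\<^esub> = \<mu>\<^bsub>B\<^esub> \<cdot> (T \<otimes> T)"
  by (simp add: assoc_hopf_def T_mult2)

lemma regular_module: "left_module B b \<mu>\<^bsub>B\<^esub>"
  using B.alg_laws by (simp add: left_module_def in_hom_iff)

text \<open>\<open>T \<circ> \<eta>\<^sub>H\<close> is an idempotent of a convolution algebra in which it is invertible.\<close>

lemma T_unit: "T \<cdot> \<eta>\<^bsub>H\<^esub> = \<eta>\<^bsub>B\<^esub>"
proof -
  have u: "coalg_morphism (\<K>, \<one> \<K>, \<one> \<K>) (coalg_of B) (T \<cdot> \<eta>\<^bsub>H\<^esub>)"
  proof -
    have "\<epsilon>\<^bsub>B\<^esub> \<cdot> (T \<cdot> \<eta>\<^bsub>H\<^esub>) = (\<epsilon>\<^bsub>B\<^esub> \<cdot> T) \<cdot> \<eta>\<^bsub>H\<^esub>" "\<delta>\<^bsub>B\<^esub> \<cdot> (T \<cdot> \<eta>\<^bsub>H\<^esub>) = (\<delta>\<^bsub>B\<^esub> \<cdot> T) \<cdot> \<eta>\<^bsub>H\<^esub>"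
      by simp_all
    then show ?thesis
      by (simp add: T_counit T_comult H.unit_coalg_laws coalg_of_def in_hom_iff interchange[symmetric])
  qed
  have "\<phi>H \<cdot> ((T \<cdot> \<eta>\<^bsub>H\<^esub>) \<otimes> \<eta>\<^bsub>H\<^esub>) = (\<phi>H \<cdot> (\<one> b \<otimes> \<eta>\<^bsub>H\<^esub>)) \<cdot> T \<cdot> \<eta>\<^bsub>H\<^esub>"
    by (simp add: slice exchange_unit)
  also have "\<dots> = \<eta>\<^bsub>H\<^esub> \<cdot> ((\<epsilon>\<^bsub>B\<^esub> \<cdot> T) \<cdot> \<eta>\<^bsub>H\<^esub>)"
    unfolding rb_laws using interchange[of "\<epsilon>\<^bsub>B\<^esub>" "\<one> \<K>" "\<one> \<K>" "\<eta>\<^bsub>H\<^esub>"] by simp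
  also have "\<dots> = \<eta>\<^bsub>H\<^esub>"
    unfolding T_counit H.unit_coalg_laws by simp
  finally have act: "\<phi>H \<cdot> ((T \<cdot> \<eta>\<^bsub>H\<^esub>) \<otimes> \<eta>\<^bsub>H\<^esub>) = \<eta>\<^bsub>H\<^esub>" .
  have "\<mu>\<^bsub>H2\<^esub> \<cdot> (\<eta>\<^bsub>H\<^esub> \<otimes> \<eta>\<^bsub>H\<^esub>) = \<mu>\<^bsub>H\<^esub> \<cdot> (\<one> h \<otimes> \<sigma>) \<cdot> ((\<delta>\<^bsub>H\<^esub> \<cdot> \<eta>\<^bsub>H\<^esub>) \<otimes> \<eta>\<^bsub>H\<^esub>)"
    unfolding mult2 convolve_def by (simp add: slice)
  also have "\<dots> = \<mu>\<^bsub>H\<^esub> \<cdot> (\<eta>\<^bsub>H\<^esub> \<otimes> (\<phi>H \<cdot> ((T \<cdot> \<eta>\<^bsub>H\<^esub>) \<otimes> \<eta>\<^bsub>H\<^esub>)))"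
    unfolding H.unit_coalg_laws by (simp add: slice)
  also have "\<dots> = (\<mu>\<^bsub>H\<^esub> \<cdot> (\<eta>\<^bsub>H\<^esub> \<otimes> \<one> h)) \<cdot> \<eta>\<^bsub>H\<^esub>"
    unfolding act by (simp add: slice exchange_unit)
  also have "\<dots> = \<eta>\<^bsub>H\<^esub>"
    unfolding H.alg_laws by simp
  finally have "\<mu>\<^bsub>H2\<^esub> \<cdot> (\<eta>\<^bsub>H\<^esub> \<otimes> \<eta>\<^bsub>H\<^esub>) = \<eta>\<^bsub>H\<^esub>" .
  then have "T \<cdot> \<eta>\<^bsub>H\<^esub> = (T \<cdot> \<mu>\<^bsub>H2\<^esub>) \<cdot> (\<eta>\<^bsub>H\<^esub> \<otimes> \<eta>\<^bsub>H\<^esub>)"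
    by simp
  \<comment> \<open>Over the trivial coalgebra \<open>\<K>\<close>, convolution is the
    multiplication of morphisms from \<open>\<K>\<close> to \<open>b\<close>. The Rota-Baxter
    equation at the unit makes \<open>T \<cdot> \<eta>\<close> of \<open>H\<close> idempotent
    there.\<close>
  then have "convolve \<mu>\<^bsub>B\<^esub> (\<one> \<K>) \<K> (T \<cdot> \<eta>\<^bsub>H\<^esub>) (T \<cdot> \<eta>\<^bsub>H\<^esub>) = T \<cdot> \<eta>\<^bsub>H\<^esub>"
    unfolding T_mult using interchange[of "\<eta>\<^bsub>H\<^esub>" T "\<eta>\<^bsub>H\<^esub>" T] by (simp add: convolve_def)
  also have "\<dots> = (\<mu>\<^bsub>B\<^esub> \<cdot> (\<one> b \<otimes> \<eta>\<^bsub>B\<^esub>)) \<cdot> T \<cdot> \<eta>\<^bsub>H\<^esub>"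
    unfolding B.alg_laws by simp
  also have "\<dots> = convolve \<mu>\<^bsub>B\<^esub> (\<one> \<K>) \<K> (T \<cdot> \<eta>\<^bsub>H\<^esub>) \<eta>\<^bsub>B\<^esub>"
    by (simp add: convolve_def slice exchange_unit)
  finally have eq: "convolve \<mu>\<^bsub>B\<^esub> (\<one> \<K>) \<K> (T \<cdot> \<eta>\<^bsub>H\<^esub>) (T \<cdot> \<eta>\<^bsub>H\<^esub>) = convolve \<mu>\<^bsub>B\<^esub> (\<one> \<K>) \<K> (T \<cdot> \<eta>\<^bsub>H\<^esub>) \<eta>\<^bsub>B\<^esub>" .
  have D: "is_coalgebra (\<K>, \<one> \<K>, \<one> \<K>)"
    by (simp add: in_hom_iff)
  have "T \<cdot> \<eta>\<^bsub>H\<^esub> \<in> hom C (\<K> \<boxtimes> \<K>) b" "\<eta>\<^bsub>B\<^esub> \<in> hom C (\<K> \<boxtimes> \<K>) b"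
    by (simp_all add: in_hom_iff)
  then show ?thesis
    using B.convolve_inverse(1)[OF regular_module D u _ unit_obj] eq by metis
qed

text \<open>In elements, \<open>\<phi>H(T(h2), \<phi>H(\<lambda>(T(h3)), x))\<close> is the action
  of \<open>T(h2)\<close> times \<open>\<lambda>(T(h3))\<close>, which collapses to the unit of
  \<open>B\<close>; the right antipode law of \<open>H\<close> remains. This one law suffices to
  recognise \<open>T \<cdot> antipode H2\<close> as the convolution inverse of \<open>T\<close>; the
  left law then comes by transport from \<open>B\<close>.\<close>

lemma antipode2_right: "\<mu>\<^bsub>H2\<^esub> \<cdot> (\<one> h \<otimes> antipode H2) \<cdot> \<delta>\<^bsub>H\<^esub> = \<eta>\<^bsub>H\<^esub> \<cdot> \<epsilon>\<^bsub>H\<^esub>"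
proof -
  have ass: "\<phi>H \<cdot> (\<one> b \<otimes> \<phi>H) = \<phi>H \<cdot> (\<mu>\<^bsub>B\<^esub> \<otimes> \<one> h)" and un: "\<phi>H \<cdot> (\<eta>\<^bsub>B\<^esub> \<otimes> \<one> h) = \<one> h"
    using rb_laws(3) by (auto simp: left_module_def)
  have TB: "\<mu>\<^bsub>B\<^esub> \<cdot> (T \<otimes> (antipode B \<cdot> T)) \<cdot> \<delta>\<^bsub>H\<^esub> = \<eta>\<^bsub>B\<^esub> \<cdot> \<epsilon>\<^bsub>H\<^esub>"
  proof -
    have "\<mu>\<^bsub>B\<^esub> \<cdot> (T \<otimes> (antipode B \<cdot> T)) \<cdot> \<delta>\<^bsub>H\<^esub> = \<mu>\<^bsub>B\<^esub> \<cdot> (\<one> b \<otimes> antipode B) \<cdot> ((T \<otimes> T) \<cdot> \<delta>\<^bsub>H\<^esub>)"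
      by (simp add: slice)
    also have "\<dots> = (\<mu>\<^bsub>B\<^esub> \<cdot> (\<one> b \<otimes> antipode B) \<cdot> \<delta>\<^bsub>B\<^esub>) \<cdot> T"
      unfolding T_comult[symmetric] by simp
    finally show ?thesis
      unfolding B.antipode_laws by (simp add: T_counit)
  qed
  have "\<mu>\<^bsub>H2\<^esub> \<cdot> (\<one> h \<otimes> antipode H2) \<cdot> \<delta>\<^bsub>H\<^esub>
    = \<mu>\<^bsub>H\<^esub> \<cdot> (\<one> h \<otimes> (\<phi>H \<cdot> (\<one> b \<otimes> \<phi>H))) \<cdot> (\<one> h \<otimes> T \<otimes> (antipode B \<cdot> T) \<otimes> antipode H)
      \<cdot> (\<one> h \<otimes> \<one> h \<otimes> \<delta>\<^bsub>H\<^esub>) \<cdot> ((\<delta>\<^bsub>H\<^esub> \<otimes> \<one> h) \<cdot> \<delta>\<^bsub>H\<^esub>)"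
    unfolding mult2 antipode2 convolve_def by (simp add: slice)
  also have "\<dots> = \<mu>\<^bsub>H\<^esub> \<cdot> (\<one> h \<otimes> (\<phi>H \<cdot> (\<mu>\<^bsub>B\<^esub> \<otimes> \<one> h))) \<cdot> (\<one> h \<otimes> T \<otimes> (antipode B \<cdot> T) \<otimes> antipode H)
      \<cdot> (\<one> h \<otimes> ((\<one> h \<otimes> \<delta>\<^bsub>H\<^esub>) \<cdot> \<delta>\<^bsub>H\<^esub>)) \<cdot> \<delta>\<^bsub>H\<^esub>"
    unfolding ass H.coalg_laws(3)[symmetric] by (simp add: slice)
  also have "\<dots> = \<mu>\<^bsub>H\<^esub> \<cdot> (\<one> h \<otimes> (\<phi>H \<cdot> (\<mu>\<^bsub>B\<^esub> \<otimes> \<one> h))) \<cdot> (\<one> h \<otimes> T \<otimes> (antipode B \<cdot> T) \<otimes> antipode H)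
      \<cdot> (\<one> h \<otimes> ((\<delta>\<^bsub>H\<^esub> \<otimes> \<one> h) \<cdot> \<delta>\<^bsub>H\<^esub>)) \<cdot> \<delta>\<^bsub>H\<^esub>"
    unfolding H.coalg_laws(3) ..
  also have "\<dots> = \<mu>\<^bsub>H\<^esub> \<cdot> (\<one> h \<otimes> (\<phi>H \<cdot> ((\<mu>\<^bsub>B\<^esub> \<cdot> (T \<otimes> (antipode B \<cdot> T)) \<cdot> \<delta>\<^bsub>H\<^esub>) \<otimes> antipode H)))
      \<cdot> (\<one> h \<otimes> \<delta>\<^bsub>H\<^esub>) \<cdot> \<delta>\<^bsub>H\<^esub>"
    by (simp add: slice)
  also have "\<dots> = \<mu>\<^bsub>H\<^esub> \<cdot> (\<one> h \<otimes> ((\<phi>H \<cdot> (\<eta>\<^bsub>B\<^esub> \<otimes> \<one> h)) \<cdot> antipode H \<cdot> ((\<epsilon>\<^bsub>H\<^esub> \<otimes> \<one> h) \<cdot> \<delta>\<^bsub>H\<^esub>))) \<cdot> \<delta>\<^bsub>H\<^esub>"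
    unfolding TB by (simp add: slice exchange_counit)
  also have "\<dots> = \<mu>\<^bsub>H\<^esub> \<cdot> (\<one> h \<otimes> antipode H) \<cdot> \<delta>\<^bsub>H\<^esub>"
    unfolding un H.coalg_laws by simp
  finally show ?thesis
    unfolding H.antipode_laws .
qed

text \<open>Both sides are convolution inverses of \<open>T\<close>.\<close>

lemma T_antipode: "T \<cdot> antipode H2 = antipode B \<cdot> T"
proof -
  have T': "coalg_morphism (h, \<epsilon>\<^bsub>H\<^esub>, \<delta>\<^bsub>H\<^esub>) (coalg_of B) T"
    using T_coalg by (simp add: coalg_of_def)
  have "convolve \<mu>\<^bsub>B\<^esub> \<delta>\<^bsub>H\<^esub> \<K> T (T \<cdot> antipode H2) = (\<mu>\<^bsub>B\<^esub> \<cdot> (T \<otimes> T)) \<cdot> (\<one> h \<otimes> antipode H2) \<cdot> \<delta>\<^bsub>H\<^esub>"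
    by (simp add: convolve_def slice)
  also have "\<dots> = T \<cdot> (\<mu>\<^bsub>H2\<^esub> \<cdot> (\<one> h \<otimes> antipode H2) \<cdot> \<delta>\<^bsub>H\<^esub>)"
    unfolding T_mult[symmetric] by simp
  also have "\<dots> = (T \<cdot> \<eta>\<^bsub>H\<^esub>) \<cdot> \<epsilon>\<^bsub>H\<^esub>"
    unfolding antipode2_right by simp
  finally have 1: "convolve \<mu>\<^bsub>B\<^esub> \<delta>\<^bsub>H\<^esub> \<K> T (T \<cdot> antipode H2) = \<eta>\<^bsub>B\<^esub> \<cdot> \<epsilon>\<^bsub>H\<^esub>"
    unfolding T_unit .
  have "convolve \<mu>\<^bsub>B\<^esub> \<delta>\<^bsub>H\<^esub> \<K> (antipode B \<cdot> T) (\<eta>\<^bsub>B\<^esub> \<cdot> \<epsilon>\<^bsub>H\<^esub>)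
    = (\<mu>\<^bsub>B\<^esub> \<cdot> (\<one> b \<otimes> \<eta>\<^bsub>B\<^esub>)) \<cdot> antipode B \<cdot> T \<cdot> ((\<one> h \<otimes> \<epsilon>\<^bsub>H\<^esub>) \<cdot> \<delta>\<^bsub>H\<^esub>)"
    by (simp add: convolve_def slice exchange_unit)
  also have "\<dots> = antipode B \<cdot> T"
    unfolding B.alg_laws H.coalg_laws by simp
  finally have 2: "convolve \<mu>\<^bsub>B\<^esub> \<delta>\<^bsub>H\<^esub> \<K> (antipode B \<cdot> T) (\<eta>\<^bsub>B\<^esub> \<cdot> \<epsilon>\<^bsub>H\<^esub>) = antipode B \<cdot> T" .
  have "T \<cdot> antipode H2 \<in> hom C (h \<boxtimes> \<K>) b"
    by (simp add: in_hom_iff)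
  then show ?thesis
    using B.convolve_inverse(1)[OF regular_module H.coalg T' _ unit_obj] 1 2 by metis
qed

sublocale iso: hopf_iso C B H2 T S
  rewrites "carr H2 = h" and "\<epsilon>\<^bsub>H2\<^esub> = \<epsilon>\<^bsub>H\<^esub>" and "\<delta>\<^bsub>H2\<^esub> = \<delta>\<^bsub>H\<^esub>" and "\<eta>\<^bsub>H2\<^esub> = \<eta>\<^bsub>H\<^esub>"
proof -
  have "coalg_of H2 = coalg_of H"
    by (simp add: coalg_of_def)
  then show "hopf_iso C B H2 T S"
    using T_coalg S T_unit T_mult T_antipode H.coalg
    by (unfold_locales) (simp_all add: in_hom_iff coalg_of_def)
qed simp_all

sublocale tw: twisted_hopf C H H2 \<sigma>
  using iso.is_hopf mult2 by unfold_locales (simp_all add: coalg_of_def in_hom_iff)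

text \<open>\<open>T\<close> respects comultiplication and slides through the braiding, so
  precomposing both sides with \<open>T\<close> yields the two sides of \<open>compat\<close>; as
  \<open>T\<close> is invertible, nothing is lost.\<close>

lemma compat_transport:
  assumes M: "left_module H M \<phi>" and p: "\<psi> \<in> hom C (b \<boxtimes> M) M"
  shows "\<psi> \<cdot> (\<one> b \<otimes> \<phi>) = \<phi> \<cdot> (\<phi>H \<otimes> \<psi>) \<cdot> (\<one> b \<otimes> \<c> b h \<otimes> \<one> M) \<cdot> (\<delta>\<^bsub>B\<^esub> \<otimes> \<one> h \<otimes> \<one> M)
    \<longleftrightarrow> tw.compat M \<phi> (\<psi> \<cdot> (T \<otimes> \<one> M))" (is "?l = ?r \<longleftrightarrow> _")
proof -
  note [simp] = H.left_module_types[OF M]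
  have [simp]: "\<psi> \<in> Arr C" "Dom C \<psi> = b \<boxtimes> M" "Cod C \<psi> = M"
    using p by (auto simp: in_hom_iff)
  have l: "?l \<cdot> (T \<otimes> \<one> (h \<boxtimes> M)) = (\<psi> \<cdot> (T \<otimes> \<one> M)) \<cdot> (\<one> h \<otimes> \<phi>)"
    by (simp add: slice)
  have nat: "(\<one> h \<otimes> T) \<cdot> \<c> h h = \<c> b h \<cdot> (T \<otimes> \<one> h)"
    using braid_natural[of T "\<one> h"] by simp
  have "?r \<cdot> (T \<otimes> \<one> (h \<boxtimes> M)) = \<phi> \<cdot> (\<phi>H \<otimes> \<psi>) \<cdot> (\<one> b \<otimes> \<c> b h \<otimes> \<one> M) \<cdot> ((\<delta>\<^bsub>B\<^esub> \<cdot> T) \<otimes> \<one> h \<otimes> \<one> M)"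
    by (simp add: slice)
  also have "\<dots> = \<phi> \<cdot> (\<phi>H \<otimes> \<psi>) \<cdot> (T \<otimes> (\<c> b h \<cdot> (T \<otimes> \<one> h)) \<otimes> \<one> M) \<cdot> (\<delta>\<^bsub>H\<^esub> \<otimes> \<one> h \<otimes> \<one> M)"
    unfolding T_comult by (simp add: slice)
  also have "\<dots> = \<phi> \<cdot> (\<sigma> \<otimes> (\<psi> \<cdot> (T \<otimes> \<one> M))) \<cdot> (\<one> h \<otimes> \<c> h h \<otimes> \<one> M) \<cdot> (\<delta>\<^bsub>H\<^esub> \<otimes> \<one> h \<otimes> \<one> M)"
    unfolding nat[symmetric] by (simp add: slice)
  finally have r: "?r \<cdot> (T \<otimes> \<one> (h \<boxtimes> M)) = \<dots>" .
  have "?l \<in> hom C (b \<boxtimes> h \<boxtimes> M) M" "?r \<in> hom C (b \<boxtimes> h \<boxtimes> M) M" "h \<boxtimes> M \<in> Obj C"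
    by (simp_all add: in_hom_iff)
  then show ?thesis
    unfolding l[symmetric] r[symmetric] using iso.T_tensor_cancel by metis
qed

text \<open>The required compatibility is the pullback along \<open>T\<close> of the axiom that the
  \<open>B\<close>-action respects the product of \<open>H\<close>.\<close>

lemma hopf_brace_assoc: "hopf_brace H H2"
proof (rule tw.hopf_brace)
  have M: "left_module H h \<mu>\<^bsub>H\<^esub>"
    using H.alg_laws by (simp add: left_module_def in_hom_iff)
  show "tw.compat h \<mu>\<^bsub>H\<^esub> \<sigma>"
    using compat_transport[OF M, of \<phi>H] rb_laws(5) by (simp add: in_hom_iff)
qed

section \<open>Comparison of modules and of their morphisms\<close>

text \<open>All conditions on the two actions on \<open>M\<close> are absorbed into the brace module
  that \<open>U\<close> produces. The typing of \<open>\<psi>\<close> is kept separately, as it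
  cannot be read off from the composite \<open>twisted_action\<close>.\<close>

lemma rb_module_iff:
  "rb_module H B T \<phi>H (M, N, \<phi>, \<psi>, \<psi>', \<gamma>) \<longleftrightarrow>
    brace_module H H2 (M, \<phi>, twisted_action H T M \<phi> \<psi>) \<and> \<psi> \<in> hom C (b \<boxtimes> M) M \<and>
    left_module B N \<psi>' \<and> \<gamma> \<in> hom C M N \<and> \<psi>' \<cdot> (T \<otimes> \<gamma>) = \<gamma> \<cdot> twisted_action H T M \<phi> \<psi>"
proof (cases "left_module H M \<phi> \<and> \<psi> \<in> hom C (b \<boxtimes> M) M")
  case True
  then have M: "left_module H M \<phi>" and p: "\<psi> \<in> hom C (b \<boxtimes> M) M" and "M \<in> Obj C"
    by (auto simp: left_module_def)
  then have p': "\<psi> \<cdot> (T \<otimes> \<one> M) \<in> hom C (h \<boxtimes> M) M"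
    by (auto simp: in_hom_iff)
  show ?thesis
    unfolding rb_module.simps compat_transport[OF M p] twisted_action_convolve tw.brace_module_iff[OF M p']
      iso.left_module_iff[OF p \<open>M \<in> Obj C\<close>]
    using M p by blast
next
  case False
  then show ?thesis
    by (auto simp: left_module_def)
qed

lemma T_S_whisk:
  assumes "f \<in> hom C (h \<boxtimes> M) N" "M \<in> Obj C"
  shows "(f \<cdot> (S \<otimes> \<one> M)) \<cdot> (T \<otimes> \<one> M) = f"
  using assms by (auto simp: in_hom_iff interchange[symmetric] iso.S_T)

lemma Gam_in_hom:
  assumes "left_module H M \<psi>1" "\<psi>2 \<in> hom C (h \<boxtimes> M) M"
  shows "Gam H M \<psi>1 \<psi>2 \<in> hom C (h \<boxtimes> M) M"
  using assms unfolding Gam_def by (auto simp: left_module_def in_hom_iff)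

lemma brace_module_laws:
  assumes "brace_module H H2 (M, \<psi>1, \<psi>2)"
  shows "left_module H M \<psi>1" "left_module H2 M \<psi>2" "M \<in> Obj C" "\<psi>2 \<in> hom C (h \<boxtimes> M) M"
    "Gam H M \<psi>1 \<psi>2 \<in> hom C (h \<boxtimes> M) M"
  using assms Gam_in_hom[of M \<psi>1 \<psi>2] by (auto simp: left_module_def)

text \<open>This is the statement that \<open>U\<close> after \<open>V\<close> is the identity on
  objects; the unit of the adjunction is accordingly an identity.\<close>

lemma twisted_action_Gam:
  assumes X: "brace_module H H2 (M, \<psi>1, \<psi>2)"
  shows "twisted_action H T M \<psi>1 (Gam H M \<psi>1 \<psi>2 \<cdot> (S \<otimes> \<one> M)) = \<psi>2"
proof -
  note M = brace_module_laws[OF X]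
  show ?thesis
    unfolding twisted_action_convolve T_S_whisk[OF M(5,3)] unfolding H.Gam_convolve
    by (rule H.convolve_antipode(2)[OF M(1,4,3)])
qed

text \<open>By \<open>twisted_action_Gam\<close> the condition on \<open>M\<close> in
  \<open>rb_module_iff\<close> is the hypothesis itself, and the one on the structure map
  \<open>\<one> M\<close> says that composing \<open>\<psi>2\<close> with \<open>S\<close> and then
  \<open>T\<close> gives back \<open>\<psi>2\<close>.\<close>

lemma rb_module_of_brace_module:
  assumes X: "brace_module H H2 (M, \<psi>1, \<psi>2)"
  shows "rb_module H B T \<phi>H (M, M, \<psi>1, Gam H M \<psi>1 \<psi>2 \<cdot> (S \<otimes> \<one> M), \<psi>2 \<cdot> (S \<otimes> \<one> M), \<one> M)"
proof -
  note M = brace_module_laws[OF X]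
  note tw = twisted_action_Gam[OF X]
  have "\<one> M \<cdot> \<psi>2 = \<psi>2"
    using M(4) by (auto simp: in_hom_iff)
  moreover have "\<psi>2 \<cdot> (S \<otimes> \<one> M) \<in> hom C (b \<boxtimes> M) M" "Gam H M \<psi>1 \<psi>2 \<cdot> (S \<otimes> \<one> M) \<in> hom C (b \<boxtimes> M) M"
    using M(3-5) by (auto simp: in_hom_iff)
  ultimately show ?thesis
    unfolding rb_module_iff tw
    using X M iso.left_module_iff T_S_whisk[OF M(4,3)] ident_hom by metis
qed

lemma Gam_morphism:
  assumes X: "brace_module H H2 (M, \<psi>1, \<psi>2)" and Y: "brace_module H H2 (P, \<chi>1, \<chi>2)"
    and f: "brace_module_morphism H H2 (M, \<psi>1, \<psi>2) (P, \<chi>1, \<chi>2) f"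
  shows "left_module_morphism B M (Gam H M \<psi>1 \<psi>2 \<cdot> (S \<otimes> \<one> M)) P (Gam H P \<chi>1 \<chi>2 \<cdot> (S \<otimes> \<one> P)) f"
proof -
  note M = brace_module_laws[OF X] and P = brace_module_laws[OF Y]
  have "f \<cdot> Gam H M \<psi>1 \<psi>2 = Gam H P \<chi>1 \<chi>2 \<cdot> (\<one> h \<otimes> f)"
    unfolding H.Gam_convolve
    using f M P by (intro convolve_natural[OF M(1) P(1)]) (auto simp: left_module_morphism_def in_hom_iff)
  moreover have "Gam H M \<psi>1 \<psi>2 \<cdot> (S \<otimes> \<one> M) \<in> hom C (b \<boxtimes> M) M" "Gam H P \<chi>1 \<chi>2 \<cdot> (S \<otimes> \<one> P) \<in> hom C (b \<boxtimes> P) P"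
    using M P by (auto simp: in_hom_iff)
  ultimately show ?thesis
    using f M(3) P(3)
    by (simp add: iso.left_module_morphism_iff T_S_whisk[OF M(5,3)] T_S_whisk[OF P(5,3)] del: comp_assoc)
      (simp add: left_module_morphism_def)
qed

lemma rb_module_morphism_of_brace_module_morphism:
  assumes X: "brace_module H H2 (M, \<psi>1, \<psi>2)" and Y: "brace_module H H2 (P, \<chi>1, \<chi>2)"
    and f: "brace_module_morphism H H2 (M, \<psi>1, \<psi>2) (P, \<chi>1, \<chi>2) f"
  shows "rb_module_morphism H B
    (M, M, \<psi>1, Gam H M \<psi>1 \<psi>2 \<cdot> (S \<otimes> \<one> M), \<psi>2 \<cdot> (S \<otimes> \<one> M), \<one> M)
    (P, P, \<chi>1, Gam H P \<chi>1 \<chi>2 \<cdot> (S \<otimes> \<one> P), \<chi>2 \<cdot> (S \<otimes> \<one> P), \<one> P) (f, f)"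
proof -
  note M = brace_module_laws[OF X] and P = brace_module_laws[OF Y]
  have "\<psi>2 \<cdot> (S \<otimes> \<one> M) \<in> hom C (b \<boxtimes> M) M" "\<chi>2 \<cdot> (S \<otimes> \<one> P) \<in> hom C (b \<boxtimes> P) P"
    using M P by (auto simp: in_hom_iff)
  then have "left_module_morphism B M (\<psi>2 \<cdot> (S \<otimes> \<one> M)) P (\<chi>2 \<cdot> (S \<otimes> \<one> P)) f"
    using f M(3) P(3)
    by (simp add: iso.left_module_morphism_iff T_S_whisk[OF M(4,3)] T_S_whisk[OF P(4,3)] del: comp_assoc)
  then show ?thesis
    using f Gam_morphism[OF X Y f] by (auto simp: left_module_morphism_def in_hom_iff)
qed

lemma rb_module_laws:
  assumes "rb_module H B T \<phi>H (M, N, \<phi>, \<psi>, \<psi>', \<gamma>)"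
  shows "brace_module H H2 (M, \<phi>, twisted_action H T M \<phi> \<psi>)" "left_module B M \<psi>" "left_module B N \<psi>'"
    "\<psi> \<in> hom C (b \<boxtimes> M) M" "\<psi>' \<in> hom C (b \<boxtimes> N) N" "N \<in> Obj C" "\<gamma> \<in> hom C M N"
    "\<psi>' \<cdot> (T \<otimes> \<gamma>) = \<gamma> \<cdot> twisted_action H T M \<phi> \<psi>"
  using assms rb_module_iff[of M N \<phi> \<psi> \<psi>' \<gamma>] by (auto simp: left_module_def)

lemma brace_module_morphism_of_rb_module_morphism:
  assumes X: "rb_module H B T \<phi>H (M, N, \<phi>, \<psi>, \<psi>', \<gamma>)" and Y: "rb_module H B T \<phi>H (P, Q, \<chi>, \<xi>, \<xi>', \<theta>)"
    and f: "rb_module_morphism H B (M, N, \<phi>, \<psi>, \<psi>', \<gamma>) (P, Q, \<chi>, \<xi>, \<xi>', \<theta>) (r, s)"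
  shows "brace_module_morphism H H2 (M, \<phi>, twisted_action H T M \<phi> \<psi>) (P, \<chi>, twisted_action H T P \<chi> \<xi>) r"
proof -
  note M = rb_module_laws[OF X] and P = rb_module_laws[OF Y]
  note M' = brace_module_laws[OF M(1)] and P' = brace_module_laws[OF P(1)]
  have t: "\<psi> \<cdot> (T \<otimes> \<one> M) \<in> hom C (h \<boxtimes> M) M" "\<xi> \<cdot> (T \<otimes> \<one> P) \<in> hom C (h \<boxtimes> P) P"
    using M(4) M'(3) P(4) P'(3) by (auto simp: in_hom_iff)
  have "left_module_morphism H2 M (\<psi> \<cdot> (T \<otimes> \<one> M)) P (\<xi> \<cdot> (T \<otimes> \<one> P)) r"
    using f iso.left_module_morphism_iff[OF M(4) M'(3) P(4) P'(3)] by simp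
  then have "r \<cdot> twisted_action H T M \<phi> \<psi> = twisted_action H T P \<chi> \<xi> \<cdot> (\<one> h \<otimes> r)"
    unfolding twisted_action_convolve
    using f t by (intro convolve_natural[OF M'(1) P'(1)]) (auto simp: left_module_morphism_def in_hom_iff)
  then show ?thesis
    using f by (auto simp: left_module_morphism_def)
qed

text \<open>Provides the inverse of the bijection. That \<open>\<theta> \<cdot> r\<close> is
  \<open>B\<close>-linear combines the linearity of \<open>r\<close> for the second brace actions
  with the defining equation of the structure map \<open>\<theta>\<close>.\<close>

lemma rb_module_morphism_extend:
  assumes X: "brace_module H H2 (M, \<psi>1, \<psi>2)" and Y: "rb_module H B T \<phi>H (P, Q, \<chi>, \<xi>, \<xi>', \<theta>)"
    and r: "brace_module_morphism H H2 (M, \<psi>1, \<psi>2) (P, \<chi>, twisted_action H T P \<chi> \<xi>) r"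
  shows "rb_module_morphism H B
    (M, M, \<psi>1, Gam H M \<psi>1 \<psi>2 \<cdot> (S \<otimes> \<one> M), \<psi>2 \<cdot> (S \<otimes> \<one> M), \<one> M) (P, Q, \<chi>, \<xi>, \<xi>', \<theta>) (r, \<theta> \<cdot> r)"
proof -
  note M = brace_module_laws[OF X] and P = rb_module_laws[OF Y]
  note P' = brace_module_laws[OF P(1)]
  let ?t = "twisted_action H T P \<chi> \<xi>"
  have [simp]: "r \<in> Arr C" "Dom C r = M" "Cod C r = P" "\<theta> \<in> Arr C" "Dom C \<theta> = P" "Cod C \<theta> = Q" "Q \<in> Obj C"
    "\<psi>2 \<in> Arr C" "Dom C \<psi>2 = h \<boxtimes> M" "Cod C \<psi>2 = M" "M \<in> Obj C" "P \<in> Obj C"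
    "\<xi>' \<in> Arr C" "Dom C \<xi>' = b \<boxtimes> Q" "Cod C \<xi>' = Q" "\<xi> \<in> Arr C" "Dom C \<xi> = b \<boxtimes> P" "Cod C \<xi> = P"
    "?t \<in> Arr C" "Dom C ?t = h \<boxtimes> P" "Cod C ?t = P"
    using r M P P' by (auto simp: left_module_morphism_def in_hom_iff)
  have "\<xi> \<cdot> (T \<otimes> \<one> P) \<in> hom C (h \<boxtimes> P) P"
    by (simp add: in_hom_iff)
  \<comment> \<open>The action \<open>\<xi>\<close> can be recovered from the brace structure on
    \<open>P\<close>, so brace linearity of \<open>r\<close> already forces its
    \<open>B\<close>-linearity.\<close>
  then have "Gam H P \<chi> ?t = \<xi> \<cdot> (T \<otimes> \<one> P)"
    unfolding H.Gam_convolve twisted_action_convolve by (rule H.convolve_antipode(1)[OF P'(1) _ P'(3)])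
  then have "Gam H P \<chi> ?t \<cdot> (S \<otimes> \<one> P) = \<xi>"
    by (simp add: interchange[symmetric] iso.T_S)
  then have 1: "left_module_morphism B M (Gam H M \<psi>1 \<psi>2 \<cdot> (S \<otimes> \<one> M)) P \<xi> r"
    using Gam_morphism[OF X P(1) r] by simp
  have "(\<theta> \<cdot> r) \<cdot> \<psi>2 = \<theta> \<cdot> r \<cdot> \<psi>2"
    by simp
  also have "r \<cdot> \<psi>2 = ?t \<cdot> (\<one> h \<otimes> r)"
    using r by (simp add: left_module_morphism_def)
  also have "\<theta> \<cdot> ?t \<cdot> (\<one> h \<otimes> r) = (\<theta> \<cdot> ?t) \<cdot> (\<one> h \<otimes> r)"
    by simp
  also have "\<dots> = (\<xi>' \<cdot> (T \<otimes> \<one> Q)) \<cdot> (\<one> h \<otimes> (\<theta> \<cdot> r))"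
    unfolding P(8)[symmetric] by (simp add: slice)
  finally have "left_module_morphism H2 M \<psi>2 Q (\<xi>' \<cdot> (T \<otimes> \<one> Q)) (\<theta> \<cdot> r)"
    by (simp add: left_module_morphism_def in_hom_iff)
  moreover have "\<psi>2 \<cdot> (S \<otimes> \<one> M) \<in> hom C (b \<boxtimes> M) M"
    by (simp add: in_hom_iff)
  ultimately have "left_module_morphism B M (\<psi>2 \<cdot> (S \<otimes> \<one> M)) Q \<xi>' (\<theta> \<cdot> r)"
    using iso.left_module_morphism_iff[OF _ M(3) P(5,6)] T_S_whisk[OF M(4,3)] by metis
  then show ?thesis
    using 1 r by simp
qed

section \<open>The two module categories and the adjunction\<close>

lemma brace_hom_system:
  "hom_system {X. brace_module H H2 X} (\<lambda>X Y. {f. brace_module_morphism H H2 X Y f}) (\<lambda>(M, \<psi>1, \<psi>2). \<one> M) (\<cdot>)"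
proof
  fix X Y Z :: "('o, 'm) brace_mod" and f g
  assume "X \<in> {X. brace_module H H2 X}" "Y \<in> {X. brace_module H H2 X}" "Z \<in> {X. brace_module H H2 X}"
    "f \<in> {f. brace_module_morphism H H2 X Y f}" "g \<in> {f. brace_module_morphism H H2 Y Z f}"
  then show "g \<cdot> f \<in> {f. brace_module_morphism H H2 X Z f}"
    by (cases X, cases Y, cases Z) (auto intro: left_module_morphism_comp)
qed (auto simp: left_module_def left_module_morphism_def in_hom_iff)

lemma rb_hom_system:
  "hom_system {X. rb_module H B T \<phi>H X} (\<lambda>X Y. {f. rb_module_morphism H B X Y f})
     (\<lambda>(M, N, \<phi>M, \<psi>M, \<psi>N, \<gamma>). (\<one> M, \<one> N)) (\<lambda>(r', s') (r, s). (r' \<cdot> r, s' \<cdot> s))"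
proof
  fix X Y Z :: "('o, 'm) rb_mod" and f g
  assume "X \<in> {X. rb_module H B T \<phi>H X}" "Y \<in> {X. rb_module H B T \<phi>H X}" "Z \<in> {X. rb_module H B T \<phi>H X}"
    "f \<in> {f. rb_module_morphism H B X Y f}" "g \<in> {f. rb_module_morphism H B Y Z f}"
  moreover obtain M N \<phi> \<psi> \<psi>' \<gamma> where X: "X = (M, N, \<phi>, \<psi>, \<psi>', \<gamma>)"
    by (cases X)
  moreover obtain M1 N1 \<phi>1 \<psi>1 \<psi>1' \<gamma>1 where Y: "Y = (M1, N1, \<phi>1, \<psi>1, \<psi>1', \<gamma>1)"
    by (cases Y)
  moreover obtain M2 N2 \<phi>2 \<psi>2 \<psi>2' \<gamma>2 where Z: "Z = (M2, N2, \<phi>2, \<psi>2, \<psi>2', \<gamma>2)"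
    by (cases Z)
  moreover obtain r s r' s' where fg: "f = (r, s)" "g = (r', s')"
    by (cases f, cases g)
  ultimately have mods: "rb_module H B T \<phi>H (M, N, \<phi>, \<psi>, \<psi>', \<gamma>)"
    "rb_module H B T \<phi>H (M1, N1, \<phi>1, \<psi>1, \<psi>1', \<gamma>1)" "rb_module H B T \<phi>H (M2, N2, \<phi>2, \<psi>2, \<psi>2', \<gamma>2)"
    and mors: "rb_module_morphism H B (M, N, \<phi>, \<psi>, \<psi>', \<gamma>) (M1, N1, \<phi>1, \<psi>1, \<psi>1', \<gamma>1) (r, s)"
    "rb_module_morphism H B (M1, N1, \<phi>1, \<psi>1, \<psi>1', \<gamma>1) (M2, N2, \<phi>2, \<psi>2, \<psi>2', \<gamma>2) (r', s')"
    by simp_all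
  have ty: "r \<in> hom C M M1" "s \<in> hom C N N1" "r' \<in> hom C M1 M2" "s' \<in> hom C N1 N2"
    "\<gamma> \<in> hom C M N" "\<gamma>1 \<in> hom C M1 N1" "\<gamma>2 \<in> hom C M2 N2"
    and sq: "s \<cdot> \<gamma> = \<gamma>1 \<cdot> r" "s' \<cdot> \<gamma>1 = \<gamma>2 \<cdot> r'"
    using mods mors by (auto simp: left_module_morphism_def)
  have "(s' \<cdot> s) \<cdot> \<gamma> = s' \<cdot> (s \<cdot> \<gamma>)"
    using ty by (auto simp: in_hom_iff)
  also have "\<dots> = (s' \<cdot> \<gamma>1) \<cdot> r"
    unfolding sq(1) using ty by (auto simp: in_hom_iff)
  also have "\<dots> = \<gamma>2 \<cdot> r' \<cdot> r"
    unfolding sq(2) using ty by (auto simp: in_hom_iff)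
  finally have "(s' \<cdot> s) \<cdot> \<gamma> = \<gamma>2 \<cdot> r' \<cdot> r" .
  moreover have "left_module_morphism H M \<phi> M2 \<phi>2 (r' \<cdot> r)" "left_module_morphism B M \<psi> M2 \<psi>2 (r' \<cdot> r)"
    "left_module_morphism B N \<psi>' N2 \<psi>2' (s' \<cdot> s)"
    using mods mors left_module_morphism_comp H.hopf_types(1) B.hopf_types(1)
    unfolding rb_module.simps rb_module_morphism.simps by metis+
  ultimately show "(case g of (r', s') \<Rightarrow> \<lambda>(r, s). (r' \<cdot> r, s' \<cdot> s)) f \<in> {f. rb_module_morphism H B X Z f}"
    unfolding X Z fg by simp
next
  fix X Y Z W :: "('o, 'm) rb_mod" and f g k
  assume "f \<in> {f. rb_module_morphism H B X Y f}" "g \<in> {f. rb_module_morphism H B Y Z f}"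
    "k \<in> {f. rb_module_morphism H B Z W f}"
  then show "(\<lambda>(r', s') (r, s). (r' \<cdot> r, s' \<cdot> s)) ((\<lambda>(r', s') (r, s). (r' \<cdot> r, s' \<cdot> s)) k g) f
    = (\<lambda>(r', s') (r, s). (r' \<cdot> r, s' \<cdot> s)) k ((\<lambda>(r', s') (r, s). (r' \<cdot> r, s' \<cdot> s)) g f)"
    by (cases X, cases Y, cases Z, cases W, cases f, cases g, cases k)
      (auto simp: left_module_morphism_def in_hom_iff)
qed (auto simp: left_module_def left_module_morphism_def in_hom_iff)

lemma V_left_adjoint_U:
  "left_adjoint (brace_Mod H H2) (rb_Mod H B T \<phi>H) (functor_V H T) (functor_U H T)"
  unfolding brace_Mod_def rb_Mod_def functor_V_def functor_U_def
proof (intro hom_adjunction.left_adjoint hom_adjunction.intro hom_adjunction_axioms.intro)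
  let ?V = "\<lambda>(M, \<psi>1, \<psi>2). (M, M, \<psi>1, Gam H M \<psi>1 \<psi>2 \<cdot> (S \<otimes> \<one> M), \<psi>2 \<cdot> (S \<otimes> \<one> M), \<one> M)"
  let ?U = "\<lambda>(M, N, \<phi>M, \<psi>M, \<psi>N, \<gamma>). (M, \<phi>M, twisted_action H T M \<phi>M \<psi>M)"
  fix X P assume XP: "X \<in> {X. brace_module H H2 X}" "P \<in> {X. rb_module H B T \<phi>H X}"
  show "bij_betw (\<lambda>(r, s). r) {f. rb_module_morphism H B (?V X) P f} {f. brace_module_morphism H H2 X (?U P) f}"
  proof -
    obtain M \<psi>1 \<psi>2 where X: "X = (M, \<psi>1, \<psi>2)"
      by (cases X)
    obtain P' Q \<chi> \<xi> \<xi>' \<theta> where P: "P = (P', Q, \<chi>, \<xi>, \<xi>', \<theta>)"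
      by (cases P)
    have X': "brace_module H H2 (M, \<psi>1, \<psi>2)" and P': "rb_module H B T \<phi>H (P', Q, \<chi>, \<xi>, \<xi>', \<theta>)"
      using XP unfolding X P by blast+
    note V = rb_module_of_brace_module[OF X']
    have tw: "twisted_action H T M \<psi>1 (Gam H M \<psi>1 \<psi>2 \<cdot> (S \<otimes> \<one> M)) = \<psi>2"
      by (rule twisted_action_Gam[OF X'])
    have "s = \<theta> \<cdot> r" if "rb_module_morphism H B (?V X) P (r, s)" for r s
      using that by (auto simp: X P left_module_morphism_def in_hom_iff)
    \<comment> \<open>\<open>U\<close> gives a morphism out of \<open>U\<close> of \<open>V\<close>
      of \<open>X\<close>; the equation \<open>tw\<close> identifies this source with
      \<open>X\<close>.\<close>
    moreover have "brace_module_morphism H H2 X (?U P) r" if "rb_module_morphism H B (?V X) P (r, s)" for r s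
      using brace_module_morphism_of_rb_module_morphism[OF V P'] that unfolding tw by (simp add: X P)
    moreover have "rb_module_morphism H B (?V X) P (r, \<theta> \<cdot> r)" if "brace_module_morphism H H2 X (?U P) r" for r
      using rb_module_morphism_extend[OF X' P'] that by (simp add: X P)
    ultimately show ?thesis
      by (intro bij_betw_byWitness[where f' = "\<lambda>r. (r, \<theta> \<cdot> r)"]) auto
  qed
qed (auto simp: brace_hom_system rb_hom_system interchange simp del: rb_module.simps rb_module_morphism.simps
    brace_module.simps brace_module_morphism.simps
    intro: rb_module_of_brace_module rb_module_morphism_of_brace_module_morphism rb_module_laws(1)
      brace_module_morphism_of_rb_module_morphism)

end

theorem theorem2p18:
  fixes C :: "('o, 'm) braided_data"
    and H B :: "('o, 'm) hopf"
    and T \<phi>H :: 'm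
  assumes "strict_braided_monoidal_category C"
    and "braided.rel_rota_baxter C H B T \<phi>H"
    and "braided.cocommutative C H"
    and "isomorphism C T"
  shows "braided.hopf_brace C H (braided.assoc_hopf C H B T \<phi>H) \<and>
    left_adjoint
      (braided.brace_Mod C H (braided.assoc_hopf C H B T \<phi>H))
      (braided.rb_Mod C H B T \<phi>H)
      (braided.functor_V C H T)
      (braided.functor_U C H T)"
proof -
  interpret rota_baxter_iso C H B T \<phi>H
    using assms by (simp add: rota_baxter_iso_def rota_baxter_iso_axioms_def)
  show ?thesis
    using hopf_brace_assoc V_left_adjoint_U by blast
qed

end
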